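(* Let $f(z)=z+\sum_{k=2}^{\infty}a_{2k-1}z^{2k-1}$ be analytic, odd and univalent in the unit disk $\mathbb{D}$, and let $g(z)=\sum_{n=1}^{\infty}b_nz^n$ be analytic in $\mathbb{D}$ with $g\prec f$. Then $M_g(r)=\sum_{n=1}^\infty|b_n|r^n\le 1$ for all $0\le r\le r_*$, where $r_*\approx 0.554958$ is the minimal positive root of the equation $x^2=(1-x)^2(1+x)$.
   Context: For analytic $f,g$ in $\mathbb{D}=\{|z|<1\}$, $g$ is subordinate to $f$, written $g\prec f$, if there exists an analytic $w:\mathbb{D}\to\mathbb{D}$ with $w(0)=0$ and $g(z)=f(w(z))$ for all $z\in\mathbb{D}$. For $h(z)=\sum h_nz^n$, $M_h(r)=\sum|h_n|r^n$. *)

theory Defs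
  imports "HOL-Complex_Analysis.Complex_Analysis"
begin

definition subordinate :: "(complex \<Rightarrow> complex) \<Rightarrow> (complex \<Rightarrow> complex) \<Rightarrow> bool" where
  "subordinate g f \<longleftrightarrow>
     (\<exists>w. w holomorphic_on ball 0 1 \<and> w ` ball 0 1 \<subseteq> ball 0 1 \<and> w 0 = 0 \<and>
          (\<forall>z\<in>ball 0 1. g z = f (w z)))"

definition taylor_coeff :: "(complex \<Rightarrow> complex) \<Rightarrow> nat \<Rightarrow> complex" where
  "taylor_coeff h n = (deriv ^^ n) h 0 / of_nat (fact n)"

definition majorant :: "(complex \<Rightarrow> complex) \<Rightarrow> real \<Rightarrow> real" where
  "majorant h r = (\<Sum>n. norm (taylor_coeff h n) * r ^ n)"

definition r_star :: real where
  "r_star = Inf {x::real. 0 < x \<and> x^2 = (1 - x)^2 * (1 + x)}"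

end

theory Submission
  imports Defs
begin

text \<open>
  Write \<open>f = \<Sum> a\<^sub>n z\<^sup>n\<close> and \<open>z / f(z) = 1 + \<Sum> c\<^sub>j z\<^sup>2\<^sup>j\<close>. The area theorem for \<open>1/f\<close> gives
  \<open>\<Sum> (2j - 1) |c\<^sub>j|\<^sup>2 \<le> 1\<close>; inverting the series yields \<open>|a\<^sub>3| \<le> 1\<close> and, since
  \<open>\<Sum> (2/3)\<^sup>j / (2j - 1) \<le> 1\<close>, also \<open>|a\<^sub>2\<^sub>m\<^sub>+\<^sub>1|\<^sup>2 \<le> (3/2)\<^sup>m\<close>. By Rogosinski's theorem
  \<open>\<Sum>\<^sub>n\<^sub><\<^sub>N |b\<^sub>n|\<^sup>2 \<le> \<Sum>\<^sub>n\<^sub><\<^sub>N |a\<^sub>n|\<^sup>2\<close> for every \<open>N\<close>. As the even coefficients of \<open>f\<close> vanish, the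
  pairs \<open>b\<^sub>2\<^sub>k\<^sub>+\<^sub>1, b\<^sub>2\<^sub>k\<^sub>+\<^sub>2\<close> may be given the common weight \<open>r\<^sup>2\<^sup>k\<close> in the Cauchy-Schwarz estimate of
  \<open>\<Sum> |b\<^sub>n| r\<^sup>n\<close>. The gain over the weights \<open>r\<^sup>n\<close> makes these crude bounds on the \<open>a\<^sub>n\<close> sufficient up
  to \<open>r = 0.555 > r\<^sub>*\<close>, in place of the sharp inequality \<open>\<Sum>\<^sub>k\<^sub>\<le>\<^sub>n |a\<^sub>2\<^sub>k\<^sub>-\<^sub>1|\<^sup>2 \<le> n\<close> of de Branges.
\<close>

section \<open>Taylor coefficients and circle means\<close>

abbreviation unit_disc :: "complex set" (\<open>\<D>\<close>) where "\<D> \<equiv> ball 0 1"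

lemma has_fps_expansion_taylor_coeff:
  assumes "h holomorphic_on \<D>"
  shows "h has_fps_expansion Abs_fps (taylor_coeff h)"
proof -
  have "h has_fps_expansion fps_expansion h 0"
    using assms by (intro has_fps_expansion_fps_expansion[of \<D>]) auto
  moreover have "fps_expansion h 0 = Abs_fps (taylor_coeff h)"
    by (rule fps_ext) (simp add: fps_expansion_def taylor_coeff_def)
  ultimately show ?thesis by simp
qed

lemma taylor_coeff_eq_fps_nth:
  assumes "H has_fps_expansion F" and "\<And>z. z \<in> \<D> \<Longrightarrow> h z = H z"
  shows "taylor_coeff h n = fps_nth F n"
proof -
  have "eventually (\<lambda>z. h z = H z) (nhds 0)"
    by (rule eventually_mono[OF eventually_nhds_in_open[of \<D>]]) (use assms(2) in auto)
  then have "h has_fps_expansion F"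
    using assms(1) has_fps_expansion_cong[of h H F F] by blast
  from fps_nth_fps_expansion[OF this, of n] show ?thesis
    by (simp add: taylor_coeff_def)
qed

lemma taylor_coeff_0 [simp]: "taylor_coeff h 0 = h 0"
  by (simp add: taylor_coeff_def)

text \<open>The difference quotient, completed by the derivative at 0, is holomorphic because the
  singularity is removable. The identity for \<open>h\<close> holds for every \<open>z\<close>, even
  outside the disc, so it rewrites without side conditions. Each use strips one coefficient from the
  series.\<close>

lemma holomorphic_split_zero:
  assumes "h holomorphic_on \<D>"
  obtains k where "k holomorphic_on \<D>" "\<And>z. h z = h 0 + z * k z" "k 0 = deriv h 0"
    "\<And>n. taylor_coeff h (Suc n) = taylor_coeff k n"
proof
  let ?k = "\<lambda>z. if z = 0 then deriv h 0 else (h z - h 0) / (z - 0)"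
  show holk: "?k holomorphic_on \<D>"
    using pole_lemma_open[OF assms, of 0] by simp
  show eq: "h z = h 0 + z * ?k z" for z by simp
  show "?k 0 = deriv h 0" by simp
  show "taylor_coeff h (Suc n) = taylor_coeff ?k n" for n
  proof -
    have "(\<lambda>z. h 0 + z * ?k z) has_fps_expansion
        (fps_const (h 0) + fps_X * Abs_fps (taylor_coeff ?k))"
      by (intro has_fps_expansion_add has_fps_expansion_mult has_fps_expansion_fps_X
          has_fps_expansion_const has_fps_expansion_taylor_coeff holk)
    from taylor_coeff_eq_fps_nth[OF this eq, of "Suc n"] show ?thesis
      by simp
  qed
qed

lemma holomorphic_taylor_remainder:
  assumes "h holomorphic_on \<D>"
  obtains R where "R holomorphic_on \<D>"
    "\<And>z. h z = (\<Sum>n<N. taylor_coeff h n * z ^ n) + z ^ N * R z"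
  using assms
proof (induction N arbitrary: h thesis)
  case 0
  then show ?case by simp
next
  case (Suc N)
  obtain k where k: "k holomorphic_on \<D>" "\<And>z. h z = h 0 + z * k z"
      "\<And>n. taylor_coeff h (Suc n) = taylor_coeff k n"
    using holomorphic_split_zero[OF Suc.prems(2)] by metis
  obtain R where R: "R holomorphic_on \<D>"
      "\<And>z. k z = (\<Sum>n<N. taylor_coeff k n * z ^ n) + z ^ N * R z"
    using Suc.IH[OF _ k(1)] by blast
  have "h z = (\<Sum>n<Suc N. taylor_coeff h n * z ^ n) + z ^ Suc N * R z" for z
    by (subst k(2), subst R(2), subst sum.lessThan_Suc_shift)
       (simp add: k(3) algebra_simps sum_distrib_left)
  with R(1) Suc.prems(1) show ?case by blast
qed

lemma taylor_coeff_symmetric: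
  assumes "h holomorphic_on \<D>" "\<And>z. z \<in> \<D> \<Longrightarrow> h (- z) = h z" "odd n"
  shows "taylor_coeff h n = 0"
proof -
  have "(deriv ^^ n) (\<lambda>z. h (-1 * z)) 0 = (-1) ^ n * (deriv ^^ n) h (-1 * 0)"
    by (rule higher_deriv_compose_linear[OF assms(1), of \<D>]) auto
  moreover have "(deriv ^^ n) (\<lambda>z. h (-1 * z)) 0 = (deriv ^^ n) h 0"
    by (rule higher_deriv_cong_ev) (auto intro!: eventually_mono[OF eventually_nhds_in_open[of \<D>]] assms(2))
  ultimately show ?thesis
    using \<open>odd n\<close> by (simp add: taylor_coeff_def)
qed

section \<open>Square means on circles\<close>

lemma has_integral_circle_zero:
  fixes \<rho> :: real
  assumes "k holomorphic_on \<D>" "0 < \<rho>" "\<rho> < 1"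
  shows "((\<lambda>t. (\<rho> * cis t) * k (\<rho> * cis t)) has_integral 0) {0..2*pi}"
proof -
  have "(k has_contour_integral 0) (circlepath 0 \<rho>)"
    by (rule Cauchy_theorem_disc_simple[OF assms(1)]) (use assms in auto)
  then have "((\<lambda>t. k (0 + \<rho> * cis t) * \<rho> * \<i> * cis t) has_integral 0) {0..2*pi}"
    unfolding circlepath_def
    by (subst (asm) has_contour_integral_part_circlepath_iff) auto
  \<comment> \<open>On the circle dz = i z dt; the factor \<open>-\<i>\<close> cancels this
    i.\<close>
  from has_integral_mult_right[OF this, of "-\<i>"] show ?thesis
    by (simp add: algebra_simps)
qed

definition circle_sqint :: "real \<Rightarrow> (complex \<Rightarrow> complex) \<Rightarrow> real" where
  "circle_sqint \<rho> h = integral {0..2*pi} (\<lambda>t. (cmod (h (\<rho> * cis t)))\<^sup>2)"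

lemma circle_in_disc: "0 < \<rho> \<Longrightarrow> \<rho> < 1 \<Longrightarrow> complex_of_real \<rho> * cis t \<in> \<D>"
  by (simp add: norm_mult)

lemma continuous_on_circle:
  fixes \<rho> :: real
  assumes "h holomorphic_on \<D>" "0 < \<rho>" "\<rho> < 1"
  shows "continuous_on A (\<lambda>t. h (\<rho> * cis t))"
  by (rule continuous_on_compose2[OF holomorphic_on_imp_continuous_on[OF assms(1)]])
     (use assms circle_in_disc in \<open>auto intro!: continuous_intros\<close>)

lemma circle_sqint_integrable:
  fixes \<rho> :: real
  assumes "h holomorphic_on \<D>" "0 < \<rho>" "\<rho> < 1"
  shows "(\<lambda>t. (cmod (h (\<rho> * cis t)))\<^sup>2) integrable_on {0..2*pi}"
  by (intro integrable_continuous_real continuous_on_power continuous_on_norm continuous_on_circle[OF assms])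

lemma circle_sqint_nonneg: "0 \<le> circle_sqint \<rho> h"
  \<comment> \<open>A function that is not integrable has integral 0 by convention, so the bound
    holds for every \<open>h\<close>.\<close>
  unfolding circle_sqint_def by (cases "(\<lambda>t. (cmod (h (\<rho> * cis t)))\<^sup>2) integrable_on {0..2*pi}")
   (auto intro: integral_nonneg simp: not_integrable_integral)

text \<open>One step of Parseval's identity: the constant \<open>c\<close> is orthogonal to
  \<open>z * k z\<close> on the circle, because the latter has mean zero. Iterating it gives
  coefficient estimates without infinite series.\<close>

lemma circle_sqint_split:
  fixes \<rho> :: real
  assumes "k holomorphic_on \<D>" "0 < \<rho>" "\<rho> < 1" "\<And>z. z \<in> \<D> \<Longrightarrow> h z = c + z * k z"
  shows "circle_sqint \<rho> h = 2 * pi * (cmod c)\<^sup>2 + \<rho>\<^sup>2 * circle_sqint \<rho> k"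
proof -
  have 1: "((\<lambda>t. 2 * Re (cnj c * ((\<rho> * cis t) * k (\<rho> * cis t)))) has_integral 0) {0..2*pi}"
  proof -
    have "((\<lambda>t. cnj c * ((\<rho> * cis t) * k (\<rho> * cis t))) has_integral cnj c * 0) {0..2*pi}"
      by (intro has_integral_mult_right has_integral_circle_zero assms)
    from has_integral_mult_right[OF has_integral_linear[OF this bounded_linear_Re], of 2]
    show ?thesis by (simp add: o_def)
  qed
  have 2: "((\<lambda>t. \<rho>\<^sup>2 * (cmod (k (\<rho> * cis t)))\<^sup>2) has_integral \<rho>\<^sup>2 * circle_sqint \<rho> k) {0..2*pi}"
    unfolding circle_sqint_def
    by (intro has_integral_mult_right integrable_integral circle_sqint_integrable[OF assms(1-3)])
  have 3: "((\<lambda>t. (cmod c)\<^sup>2) has_integral (2 * pi * (cmod c)\<^sup>2)) {0..2*pi}"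
    using has_integral_const_real[of "(cmod c)\<^sup>2" 0 "2*pi"] by simp
  have exp: "(cmod (c + x))\<^sup>2 = (cmod c)\<^sup>2 + 2 * Re (cnj c * x) + (cmod x)\<^sup>2" for x
    unfolding cmod_power2 by (simp add: power2_eq_square algebra_simps)
  have "(cmod (h (\<rho> * cis t)))\<^sup>2 = (cmod c)\<^sup>2 + 2 * Re (cnj c * ((\<rho> * cis t) * k (\<rho> * cis t)))
      + \<rho>\<^sup>2 * (cmod (k (\<rho> * cis t)))\<^sup>2" for t
    by (simp add: assms(4)[OF circle_in_disc[OF assms(2,3)]] exp norm_mult power_mult_distrib)
  then have "((\<lambda>t. (cmod (h (\<rho> * cis t)))\<^sup>2) has_integral
      (2 * pi * (cmod c)\<^sup>2 + 0 + \<rho>\<^sup>2 * circle_sqint \<rho> k)) {0..2*pi}"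
    using has_integral_add[OF has_integral_add[OF 3 1] 2] by simp
  from integral_unique[OF this] show ?thesis
    unfolding circle_sqint_def[of \<rho> h] by (simp only: add_0_right)
qed

text \<open>Coefficients are split off one at a time; the nonnegative square integral left after
  \<open>N\<close> steps is dropped.\<close>

lemma circle_sqint_bessel:
  fixes \<rho> :: real
  assumes "h holomorphic_on \<D>" "0 < \<rho>" "\<rho> < 1"
  shows "2 * pi * (\<Sum>n<N. (cmod (taylor_coeff h n))\<^sup>2 * \<rho> ^ (2 * n)) \<le> circle_sqint \<rho> h"
  using assms(1)
proof (induction N arbitrary: h)
  case 0
  then show ?case by (simp add: circle_sqint_nonneg)
next
  case (Suc N)
  obtain k where k: "k holomorphic_on \<D>" "\<And>z. h z = h 0 + z * k z"
      "\<And>n. taylor_coeff h (Suc n) = taylor_coeff k n"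
    using holomorphic_split_zero[OF Suc.prems] by metis
  have "2 * pi * (\<Sum>n<Suc N. (cmod (taylor_coeff h n))\<^sup>2 * \<rho> ^ (2 * n)) =
      2 * pi * (cmod (h 0))\<^sup>2 + \<rho>\<^sup>2 * (2 * pi * (\<Sum>n<N. (cmod (taylor_coeff k n))\<^sup>2 * \<rho> ^ (2 * n)))"
    by (subst sum.lessThan_Suc_shift)
       (simp add: k(3) algebra_simps sum_distrib_left power_add power2_eq_square)
  also have "\<dots> \<le> 2 * pi * (cmod (h 0))\<^sup>2 + \<rho>\<^sup>2 * circle_sqint \<rho> k"
    using Suc.IH[OF k(1)] by (intro add_left_mono mult_left_mono) auto
  also have "\<dots> = circle_sqint \<rho> h"
    using circle_sqint_split[OF k(1) assms(2,3) k(2)] by simp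
  finally show ?case .
qed

section \<open>Littlewood subordination and Rogosinski's theorem\<close>

text \<open>Horner's scheme writes the polynomial in \<open>w\<close> as \<open>p 0 + w * Q\<close>.
  As \<open>w = z * v\<close>, the constant is orthogonal to the rest, from which the factor
  \<open>w\<close> of modulus at most 1 can be discarded. \<open>Q\<close> has the shifted
  coefficients, hence the induction over arbitrary \<open>p\<close>.\<close>

lemma littlewood_subordination_poly:
  assumes "w holomorphic_on \<D>" "w ` \<D> \<subseteq> \<D>" "w 0 = 0" "0 < \<rho>" "\<rho> < 1"
  shows "circle_sqint \<rho> (\<lambda>z. \<Sum>n<N. p n * w z ^ n) \<le> 2 * pi * (\<Sum>n<N. (cmod (p n))\<^sup>2)"
proof (induction N arbitrary: p)
  case 0
  then show ?case by (simp add: circle_sqint_def)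
next
  case (Suc N)
  obtain v where v: "v holomorphic_on \<D>" "\<And>z. w z = w 0 + z * v z"
    using holomorphic_split_zero[OF assms(1)] by metis
  define Q where "Q = (\<lambda>z. \<Sum>n<N. p (Suc n) * w z ^ n)"
  have holQ: "Q holomorphic_on \<D>"
    unfolding Q_def by (intro holomorphic_intros assms)
  have wle: "cmod (w z) \<le> 1" if "z \<in> \<D>" for z
    using assms(2) that by force
  have split: "circle_sqint \<rho> (\<lambda>z. c + w z * Q z) =
      2 * pi * (cmod c)\<^sup>2 + \<rho>\<^sup>2 * circle_sqint \<rho> (\<lambda>z. v z * Q z)" for c
    by (rule circle_sqint_split) (use v assms holQ in \<open>auto intro!: holomorphic_intros\<close>)
  have "circle_sqint \<rho> (\<lambda>z. w z * Q z) \<le> circle_sqint \<rho> Q"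
    unfolding circle_sqint_def
  proof (rule integral_le)
    show "(cmod (w (\<rho> * cis t) * Q (\<rho> * cis t)))\<^sup>2 \<le> (cmod (Q (\<rho> * cis t)))\<^sup>2" for t
      using wle[OF circle_in_disc[OF assms(4,5)], of t]
      by (intro power_mono) (auto simp: norm_mult mult_left_le_one_le)
    show "(\<lambda>t. (cmod (w (\<rho> * cis t) * Q (\<rho> * cis t)))\<^sup>2) integrable_on {0..2*pi}"
      by (rule circle_sqint_integrable[OF holomorphic_on_mult[OF assms(1) holQ] assms(4,5)])
    show "(\<lambda>t. (cmod (Q (\<rho> * cis t)))\<^sup>2) integrable_on {0..2*pi}"
      by (rule circle_sqint_integrable[OF holQ assms(4,5)])
  qed
  also have "\<dots> \<le> 2 * pi * (\<Sum>n<N. (cmod (p (Suc n)))\<^sup>2)"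
    unfolding Q_def by (rule Suc.IH)
  \<comment> \<open>The instances of \<open>split\<close> at 0 and at \<open>p 0\<close> share the
    term in \<open>v * Q\<close>; eliminating it expresses the square integral of
    \<open>p 0 + w * Q\<close> through that of \<open>w * Q\<close>.\<close>
  finally have "circle_sqint \<rho> (\<lambda>z. p 0 + w z * Q z) \<le>
      2 * pi * (cmod (p 0))\<^sup>2 + 2 * pi * (\<Sum>n<N. (cmod (p (Suc n)))\<^sup>2)"
    using split[of 0] split[of "p 0"] by simp
  moreover have "(\<lambda>z. \<Sum>n<Suc N. p n * w z ^ n) = (\<lambda>z. p 0 + w z * Q z)"
    unfolding Q_def by (rule ext, subst sum.lessThan_Suc_shift) (simp add: sum_distrib_left algebra_simps)
  ultimately show ?case
    unfolding sum.lessThan_Suc_shift[of "\<lambda>n. (cmod (p n))\<^sup>2"] by (simp add: algebra_simps)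
qed

text \<open>The part \<open>Q\<close> of degree below \<open>N\<close> in \<open>w\<close>
  determines the first \<open>N\<close> coefficients of \<open>g\<close>: the remainder of
  \<open>f\<close>, composed with \<open>w\<close>, is divisible by \<open>z ^ N\<close> because
  \<open>w 0 = 0\<close>. Bessel's inequality and Littlewood's bound apply to \<open>Q\<close> on
  the circle of radius \<open>\<rho>\<close>; then \<open>\<rho>\<close> tends to 1.\<close>

lemma rogosinski_subordination:
  assumes "f holomorphic_on \<D>" "g holomorphic_on \<D>" "subordinate g f"
  shows "(\<Sum>n<N. (cmod (taylor_coeff g n))\<^sup>2) \<le> (\<Sum>n<N. (cmod (taylor_coeff f n))\<^sup>2)"
proof -
  obtain w where w: "w holomorphic_on \<D>" "w ` \<D> \<subseteq> \<D>" "w 0 = 0"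
      and gf: "\<And>z. z \<in> \<D> \<Longrightarrow> g z = f (w z)"
    using assms(3) unfolding subordinate_def by auto
  obtain v where v: "v holomorphic_on \<D>" "\<And>z. w z = w 0 + z * v z"
    using holomorphic_split_zero[OF w(1)] by metis
  obtain R where R: "R holomorphic_on \<D>"
      "\<And>z. f z = (\<Sum>n<N. taylor_coeff f n * z ^ n) + z ^ N * R z"
    using holomorphic_taylor_remainder[OF assms(1)] by blast
  define Q where "Q = (\<lambda>z. \<Sum>n<N. taylor_coeff f n * w z ^ n)"
  have holQ: "Q holomorphic_on \<D>"
    unfolding Q_def by (intro holomorphic_intros w)
  define S where "S = (\<lambda>z. v z ^ N * R (w z))"
  have holS: "S holomorphic_on \<D>"
    unfolding S_def
    by (intro holomorphic_intros v holomorphic_on_compose_gen[OF w(1) R(1) w(2), unfolded o_def])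
  have "g z = Q z + z ^ N * S z" if "z \<in> \<D>" for z
    using gf[OF that] R(2)[of "w z"] v(2)[of z] w(3)
    by (simp add: Q_def S_def power_mult_distrib)
  moreover have "(\<lambda>z. Q z + z ^ N * S z) has_fps_expansion
      (Abs_fps (taylor_coeff Q) + fps_X ^ N * Abs_fps (taylor_coeff S))"
    by (intro has_fps_expansion_add has_fps_expansion_mult has_fps_expansion_fps_X_power
        has_fps_expansion_taylor_coeff holQ holS)
  ultimately have coeff: "taylor_coeff g n = taylor_coeff Q n" if "n < N" for n
    using taylor_coeff_eq_fps_nth[of _ _ g n] that by (simp add: fps_X_power_mult_nth)
  have le: "(\<Sum>n<N. (cmod (taylor_coeff g n))\<^sup>2 * \<rho> ^ (2 * n)) \<le> (\<Sum>n<N. (cmod (taylor_coeff f n))\<^sup>2)"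
    if "0 < \<rho>" "\<rho> < 1" for \<rho> :: real
  proof -
    have "2 * pi * (\<Sum>n<N. (cmod (taylor_coeff g n))\<^sup>2 * \<rho> ^ (2 * n)) \<le> circle_sqint \<rho> Q"
      using circle_sqint_bessel[OF holQ that, of N] by (simp add: coeff)
    also have "\<dots> \<le> 2 * pi * (\<Sum>n<N. (cmod (taylor_coeff f n))\<^sup>2)"
      unfolding Q_def by (rule littlewood_subordination_poly[OF w that])
    finally show ?thesis by simp
  qed
  have "((\<lambda>\<rho>. \<Sum>n<N. (cmod (taylor_coeff g n))\<^sup>2 * \<rho> ^ (2 * n)) \<longlongrightarrow>
      (\<Sum>n<N. (cmod (taylor_coeff g n))\<^sup>2 * 1 ^ (2 * n))) (at_left (1::real))"
    by (intro tendsto_intros)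
  moreover have "\<forall>\<^sub>F \<rho> in at_left (1::real). 0 < \<rho> \<and> \<rho> < 1"
    using eventually_at_left_field zero_less_one by blast
  then have "\<forall>\<^sub>F \<rho> in at_left (1::real). (\<Sum>n<N. (cmod (taylor_coeff g n))\<^sup>2 * \<rho> ^ (2 * n))
      \<le> (\<Sum>n<N. (cmod (taylor_coeff f n))\<^sup>2)"
    by (rule eventually_mono) (use le in auto)
  ultimately have "(\<Sum>n<N. (cmod (taylor_coeff g n))\<^sup>2 * 1 ^ (2 * n)) \<le> (\<Sum>n<N. (cmod (taylor_coeff f n))\<^sup>2)"
    by (rule tendsto_upperbound) auto
  then show ?thesis by simp
qed

section \<open>The area theorem\<close>

text \<open>Real coordinates for the plane: the change of variables formula takes its Jacobian from
  a matrix acting on \<open>real^2\<close>.\<close>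

definition vec_of_complex :: "complex \<Rightarrow> real^2" where
  "vec_of_complex z = vector [Re z, Im z]"

definition complex_of_vec :: "real^2 \<Rightarrow> complex" where
  "complex_of_vec x = Complex (x $ 1) (x $ 2)"

lemma vec_of_complex_nth [simp]:
  "vec_of_complex z $ 1 = Re z" "vec_of_complex z $ 2 = Im z"
  by (simp_all add: vec_of_complex_def)

lemma complex_of_vec_sel [simp]:
  "Re (complex_of_vec x) = x $ 1" "Im (complex_of_vec x) = x $ 2"
  by (simp_all add: complex_of_vec_def)

lemma complex_of_vec_inverse [simp]: "vec_of_complex (complex_of_vec x) = x"
  by (simp add: vec_eq_iff forall_2)

lemma vec_of_complex_inverse [simp]: "complex_of_vec (vec_of_complex z) = z"
  by (simp add: complex_eq_iff)

lemma bounded_linear_vec_of_complex: "bounded_linear vec_of_complex"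
  by (intro linear_conv_bounded_linear[THEN iffD1] linearI) (auto simp: vec_eq_iff forall_2)

lemma bounded_linear_complex_of_vec: "bounded_linear complex_of_vec"
  by (intro linear_conv_bounded_linear[THEN iffD1] linearI) (auto simp: complex_eq_iff)

lemma norm_vec_of_complex: "norm (vec_of_complex z) = cmod z"
  by (simp add: norm_vec_def L2_set_def sum_2 cmod_def)

lemma det_matrix_2: "det (matrix (L :: real^2 \<Rightarrow> real^2)) =
    L (axis 1 1) $ 1 * L (axis 2 1) $ 2 - L (axis 2 1) $ 1 * L (axis 1 1) $ 2"
  by (simp add: det_2 matrix_def)

lemma complex_of_vec_axis [simp]:
  "complex_of_vec (axis 1 1) = 1" "complex_of_vec (axis 2 1) = \<i>"
  by (auto simp: complex_eq_iff axis_def)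

text \<open>The coordinate map between \<open>real^2\<close> and pairs preserves boxes and their
  contents, so Fubini's theorem on pairs carries over.\<close>

lemma has_integral_vec2:
  fixes F :: "real \<times> real \<Rightarrow> real"
  assumes "continuous_on (cbox (a,c) (b,d)) F"
  shows "((\<lambda>x. F (x $ 1, x $ 2)) has_integral
      integral {a..b} (\<lambda>s. integral {c..d} (\<lambda>t. F (s, t)))) (cbox (vector [a,c] :: real^2) (vector [b,d]))"
proof -
  let ?g = "\<lambda>x::real^2. (x $ 1, x $ 2)" and ?h = "\<lambda>p::real\<times>real. (vector [fst p, snd p] :: real^2)"
  have gbox: "?g ` cbox u v = cbox (u $ 1, u $ 2) (v $ 1, v $ 2)" for u v
  proof (intro equalityI subsetI)
    fix p assume "p \<in> cbox (u $ 1, u $ 2) (v $ 1, v $ 2)"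
    then have "?h p \<in> cbox u v" "p = ?g (?h p)"
      by (auto simp: mem_box_cart forall_2 cbox_Pair_eq)
    then show "p \<in> ?g ` cbox u v" by blast
  qed (auto simp: mem_box_cart forall_2 cbox_Pair_eq)
  have hbox: "?h ` cbox u v = cbox (?h u) (?h v)" for u v
  proof (intro equalityI subsetI)
    fix x assume "x \<in> cbox (?h u) (?h v)"
    then have "?g x \<in> cbox u v" "x = ?h (?g x)"
      by (cases u; cases v; auto simp: mem_box_cart forall_2 cbox_Pair_eq vec_eq_iff)+
    then show "x \<in> ?h ` cbox u v" by blast
  qed (cases u; cases v; auto simp: mem_box_cart forall_2 cbox_Pair_eq)
  have "((\<lambda>x. F (?g x)) has_integral (1 / 1) *\<^sub>R integral (cbox (a,c) (b,d)) F) (?h ` cbox (a,c) (b,d))"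
  proof (rule has_integral_twiddle)
    show "continuous (at x) ?g" for x :: "real^2" by (intro continuous_intros)
    show "measure lborel (?g ` cbox u v) = 1 * measure lborel (cbox u v)" for u v
    proof (cases "u $ 1 \<le> v $ 1 \<and> u $ 2 \<le> v $ 2")
      case True
      then have "cbox u v \<noteq> {}" by (simp add: interval_ne_empty_cart forall_2)
      with True show ?thesis
        unfolding gbox content_Pair by (simp add: content_cbox_if_cart UNIV_2)
    next
      case False
      then have "cbox u v = {}" using interval_ne_empty_cart(1)[of u v] by (auto simp: forall_2)
      then show ?thesis by simp
    qed
    show "(F has_integral integral (cbox (a, c) (b, d)) F) (cbox (a, c) (b, d))"
      using integrable_continuous[OF assms] by (rule integrable_integral)
    show "?h (?g x) = x" for x by (simp add: vec_eq_iff forall_2)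
    show "\<exists>w z. ?g ` cbox u v = cbox w z" for u v using gbox by blast
    show "\<exists>w z. ?h ` cbox u v = cbox w z" for u v using hbox by blast
  qed auto
  moreover have "integral (cbox (a,c) (b,d)) F = integral {a..b} (\<lambda>s. integral {c..d} (\<lambda>t. F (s, t)))"
    using integral_prod_continuous[OF assms] by simp
  ultimately show ?thesis by (simp add: hbox)
qed

text \<open>The Jacobian of \<open>G\<close> is the squared modulus of \<open>G'\<close>, so for
  injective \<open>G\<close> the integral is the area of the image. The real-linear map from w to
  \<open>w - q * cnj w\<close> has determinant 1 - |q|^2 and takes the image into a disc of radius
  \<open>R\<close>.\<close>

lemma rectangle_area_bound:
  fixes G G' :: "complex \<Rightarrow> complex" and q :: complex
  assumes der: "\<And>z. Re z \<in> {a..b} \<Longrightarrow> Im z \<in> {c..d} \<Longrightarrow> (G has_field_derivative G' z) (at z)"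
    and cont: "continuous_on {z. Re z \<in> {a..b} \<and> Im z \<in> {c..d}} G'"
    and inj: "inj_on G {z. Re z \<in> {a<..<b} \<and> Im z \<in> {c<..<d}}"
    and bound: "\<And>z. Re z \<in> {a<..<b} \<Longrightarrow> Im z \<in> {c<..<d} \<Longrightarrow> cmod (G z - q * cnj (G z)) < R"
    and q: "cmod q \<le> 1" and R: "0 \<le> R"
  shows "(1 - (cmod q)\<^sup>2) * integral {a..b} (\<lambda>s. integral {c..d} (\<lambda>t. (cmod (G' (Complex s t)))\<^sup>2)) \<le> pi * R\<^sup>2"
proof -
  define J where "J = integral {a..b} (\<lambda>s. integral {c..d} (\<lambda>t. (cmod (G' (Complex s t)))\<^sup>2))"
  \<comment> \<open>The open rectangle, as injectivity is available only there; it differs from the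
    closed box by a null set.\<close>
  define S where "S = box (vector [a,c] :: real^2) (vector [b,d])"
  define \<Phi> where "\<Phi> = (\<lambda>x. vec_of_complex (G (complex_of_vec x)))"
  define \<Phi>' where "\<Phi>' = (\<lambda>x h. vec_of_complex (G' (complex_of_vec x) * complex_of_vec h))"
  define L where "L = (\<lambda>x. vec_of_complex (complex_of_vec x - q * cnj (complex_of_vec x)))"
  have S_iff: "x \<in> S \<longleftrightarrow> Re (complex_of_vec x) \<in> {a<..<b} \<and> Im (complex_of_vec x) \<in> {c<..<d}" for x
    by (auto simp: S_def mem_box_cart forall_2)
  have d: "(\<Phi> has_derivative \<Phi>' x) (at x within S)" if "x \<in> S" for x
  proof -
    have "(G has_derivative (\<lambda>h. G' (complex_of_vec x) * h)) (at (complex_of_vec x))"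
      using that der[of "complex_of_vec x"] by (simp add: S_iff has_field_derivative_def)
    from has_derivative_compose[OF bounded_linear_imp_has_derivative[OF bounded_linear_complex_of_vec] this]
    have "((\<lambda>x. G (complex_of_vec x)) has_derivative (\<lambda>h. G' (complex_of_vec x) * complex_of_vec h)) (at x)" .
    from bounded_linear.has_derivative[OF bounded_linear_vec_of_complex this]
    show ?thesis unfolding \<Phi>_def \<Phi>'_def by (rule has_derivative_at_withinI)
  qed
  have inj\<Phi>: "inj_on \<Phi> S"
  proof (rule inj_onI)
    fix x y assume xy: "x \<in> S" "y \<in> S" "\<Phi> x = \<Phi> y"
    then have "G (complex_of_vec x) = G (complex_of_vec y)"
      unfolding \<Phi>_def by (metis vec_of_complex_inverse)
    with xy inj have "complex_of_vec x = complex_of_vec y"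
      by (auto simp: S_iff inj_on_def)
    then show "x = y" by (metis complex_of_vec_inverse)
  qed
  have det: "\<bar>det (matrix (\<Phi>' x))\<bar> = (cmod (G' (complex_of_vec x)))\<^sup>2" for x
    by (simp add: det_matrix_2 \<Phi>'_def cmod_power2) (simp add: power2_eq_square)
  have contF: "continuous_on (cbox (a,c) (b,d)) (\<lambda>p. (cmod (G' (Complex (fst p) (snd p))))\<^sup>2)"
    by (intro continuous_intros continuous_on_compose2[OF cont])
       (auto simp: cbox_Pair_eq Complex_eq intro!: continuous_intros)
  have "((\<lambda>x. (cmod (G' (complex_of_vec x)))\<^sup>2) has_integral J) (cbox (vector [a,c]) (vector [b,d]))"
    using has_integral_vec2[OF contF] by (simp add: J_def complex_of_vec_def)
  then have "((\<lambda>x. \<bar>det (matrix (\<Phi>' x))\<bar>) has_integral J) S"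
    by (simp add: det S_def has_integral_open_interval)
  with has_measure_differentiable_image[of S \<Phi> \<Phi>' J] d inj\<Phi>
  have m: "\<Phi> ` S \<in> lmeasurable" "measure lebesgue (\<Phi> ` S) = J"
    by (auto simp: S_def)
  have linL: "linear L"
    unfolding L_def by (rule linearI) (auto simp: vec_eq_iff forall_2 algebra_simps)
  have "\<bar>det (matrix L)\<bar> = \<bar>1 - (cmod q)\<^sup>2\<bar>"
    by (simp add: det_matrix_2 L_def cmod_power2) (simp add: power2_eq_square algebra_simps)
  also have "\<dots> = 1 - (cmod q)\<^sup>2"
    using q by (simp add: power_le_one)
  finally have "measure lebesgue (L ` (\<Phi> ` S)) = (1 - (cmod q)\<^sup>2) * J"
    using measure_linear_image[OF linL m(1)] m(2) by simp
  moreover have "measure lebesgue (L ` (\<Phi> ` S)) \<le> measure lebesgue (ball (0::real^2) R)"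
  proof (rule measure_mono_fmeasurable)
    show "L ` (\<Phi> ` S) \<subseteq> ball 0 R"
      using bound by (auto simp: L_def \<Phi>_def norm_vec_of_complex S_iff)
    show "L ` (\<Phi> ` S) \<in> sets lebesgue"
      using measurable_linear_image[OF linL m(1)] by auto
  qed auto
  moreover have "measure lebesgue (ball (0::real^2) R) = pi * R\<^sup>2"
    using circle_area[OF R, of "0::real^2"] by simp
  ultimately show ?thesis by (simp add: J_def)
qed

section \<open>Images of small circles around the pole\<close>

text \<open>At \<open>t = \<epsilon>\<close> the first two terms equal
  \<open>1 / \<epsilon>\<close>; for larger \<open>t\<close> they fall below it by at least
  \<open>(t - \<epsilon>) / t * (1 / (2 * \<epsilon>))\<close>. Up to
  \<open>t = 2 * \<epsilon>\<close> the error \<open>B * t\<^sup>2\<close> is at most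
  \<open>4 * B * \<epsilon>\<^sup>2\<close>; beyond, the drop is at least
  \<open>1 / (4 * \<epsilon>)\<close> and absorbs \<open>B\<close>.\<close>

lemma ellipse_radius_estimate:
  fixes C B \<epsilon> t :: real
  assumes "0 \<le> C" "0 \<le> B" "0 < \<epsilon>" "\<epsilon> \<le> t" "t \<le> 1" "4 * C * \<epsilon> \<le> 1" "4 * B * \<epsilon> \<le> 1"
  shows "1 / t + C * (t\<^sup>2 - \<epsilon>\<^sup>2) / t + B * t\<^sup>2 \<le> 1 / \<epsilon> + 4 * B * \<epsilon>\<^sup>2"
proof -
  have t: "0 < t" using assms by simp
  have "C * (t + \<epsilon>) * (2 * \<epsilon>) \<le> C * 2 * (2 * \<epsilon>)"
    using assms by (intro mult_right_mono mult_left_mono) auto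
  also have "\<dots> \<le> 1" using assms by simp
  finally have half: "C * (t + \<epsilon>) \<le> 1 / (2 * \<epsilon>)"
    using assms by (simp add: field_simps)
  have "1 / \<epsilon> - (1 / t + C * (t\<^sup>2 - \<epsilon>\<^sup>2) / t) = (t - \<epsilon>) / t * (1 / \<epsilon> - C * (t + \<epsilon>))"
    using t assms by (simp add: field_simps power2_eq_square)
  also have "\<dots> \<ge> (t - \<epsilon>) / t * (1 / (2 * \<epsilon>))"
    using half t assms by (intro mult_left_mono) (auto simp: field_simps)
  finally have main: "(t - \<epsilon>) / t * (1 / (2 * \<epsilon>)) \<le> 1 / \<epsilon> - (1 / t + C * (t\<^sup>2 - \<epsilon>\<^sup>2) / t)" .
  show ?thesis
  proof (cases "t \<le> 2 * \<epsilon>")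
    case True
    have "B * t\<^sup>2 \<le> B * (2 * \<epsilon>)\<^sup>2"
      using assms True by (intro mult_left_mono power_mono) auto
    moreover have "0 \<le> (t - \<epsilon>) / t * (1 / (2 * \<epsilon>))"
      using assms t by simp
    ultimately show ?thesis using main by (simp add: power_mult_distrib)
  next
    case False
    have "B * t\<^sup>2 \<le> B * 1"
      using assms t by (intro mult_left_mono) (auto simp: power_le_one)
    also have "\<dots> \<le> 1 / 2 * (1 / (2 * \<epsilon>))"
      using assms by (simp add: field_simps)
    also have "\<dots> \<le> (t - \<epsilon>) / t * (1 / (2 * \<epsilon>))"
      using False t assms by (intro mult_right_mono) (auto simp: field_simps)
    finally have "B * t\<^sup>2 \<le> (t - \<epsilon>) / t * (1 / (2 * \<epsilon>))" .
    moreover have "0 \<le> 4 * B * \<epsilon>\<^sup>2" using assms by simp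
    ultimately show ?thesis using main by linarith
  qed
qed

text \<open>Under \<open>w \<mapsto> w - c \<epsilon>\<^sup>2 cnj w\<close> the image of the circle of radius \<open>\<epsilon>\<close> under \<open>1/z + c z\<close>,
  an ellipse, becomes a circle up to an error \<open>O(\<epsilon>\<^sup>2)\<close> in the radius.\<close>

lemma ellipse_containment:
  fixes c z w :: complex and K \<epsilon> :: real
  defines "B \<equiv> K + cmod c * K + (cmod c)\<^sup>2"
  assumes "0 \<le> K" "0 < \<epsilon>" "\<epsilon> \<le> cmod z" "cmod z \<le> 1" "4 * cmod c * \<epsilon> \<le> 1" "4 * B * \<epsilon> \<le> 1"
    and w: "cmod (w - (1 / z + c * z)) \<le> K * (cmod z)\<^sup>2"
  shows "cmod (w - c * \<epsilon>\<^sup>2 * cnj w) \<le> 1 / \<epsilon> + 4 * B * \<epsilon>\<^sup>2"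
proof -
  define e where "e = w - (1 / z + c * z)"
  define t where "t = cmod z"
  have t: "0 < t" "\<epsilon> \<le> t" "t \<le> 1" using assms by (auto simp: t_def)
  have z: "z \<noteq> 0" using t by (auto simp: t_def)
  have e: "cmod e \<le> K * t\<^sup>2" using w by (simp add: e_def t_def)
  \<comment> \<open>\<open>\<epsilon>\<^sup>2 / cnj z\<close> is the reflection of \<open>z\<close>
    in the circle of radius \<open>\<epsilon>\<close>, a positive multiple of \<open>z\<close>; the
    difference vanishes on that circle.\<close>
  have "z - \<epsilon>\<^sup>2 / cnj z = z * of_real (1 - \<epsilon>\<^sup>2 / t\<^sup>2)"
    using z complex_norm_square[of z] by (simp add: t_def field_simps)
  then have n1: "cmod (z - \<epsilon>\<^sup>2 / cnj z) = (t\<^sup>2 - \<epsilon>\<^sup>2) / t"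
    using t power_mono[of \<epsilon> t 2] assms
    by (simp add: norm_mult t_def[symmetric] del: of_real_diff of_real_divide)
       (simp add: field_simps power2_eq_square)
  \<comment> \<open>The term \<open>1 / cnj z\<close> coming from \<open>cnj w\<close> is grouped
    with \<open>c * z\<close>, which it cancels on the circle of radius
    \<open>\<epsilon>\<close>.\<close>
  have "w - c * \<epsilon>\<^sup>2 * cnj w = 1 / z + c * (z - \<epsilon>\<^sup>2 / cnj z) + e - c * \<epsilon>\<^sup>2 * (cnj c * cnj z + cnj e)"
    using z by (simp add: e_def algebra_simps)
  also have "cmod \<dots> \<le> cmod (1 / z) + cmod (c * (z - \<epsilon>\<^sup>2 / cnj z)) + cmod e
      + cmod (c * \<epsilon>\<^sup>2 * (cnj c * cnj z + cnj e))"
    by (intro norm_triangle_le_diff norm_triangle_le add_mono order_refl)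
  also have "\<dots> \<le> 1 / t + cmod c * ((t\<^sup>2 - \<epsilon>\<^sup>2) / t) + K * t\<^sup>2 + cmod c * \<epsilon>\<^sup>2 * (cmod c * t + K * t\<^sup>2)"
  proof (intro add_mono)
    have "cmod (cnj c * cnj z + cnj e) \<le> cmod c * t + K * t\<^sup>2"
      using norm_triangle_ineq[of "cnj c * cnj z" "cnj e"] e by (simp add: norm_mult t_def)
    then show "cmod (c * \<epsilon>\<^sup>2 * (cnj c * cnj z + cnj e)) \<le> cmod c * \<epsilon>\<^sup>2 * (cmod c * t + K * t\<^sup>2)"
      by (simp add: norm_mult norm_power mult_left_mono)
  qed (use e n1 in \<open>auto simp: norm_mult norm_divide t_def\<close>)
  also have "\<dots> \<le> 1 / t + cmod c * (t\<^sup>2 - \<epsilon>\<^sup>2) / t + B * t\<^sup>2"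
  proof -
    have \<epsilon>: "\<epsilon>\<^sup>2 \<le> t\<^sup>2" "\<epsilon>\<^sup>2 \<le> 1" using t assms by (auto intro: power_mono power_le_one)
    have "\<epsilon>\<^sup>2 * t \<le> t\<^sup>2 * 1"
      using t \<epsilon> by (intro mult_mono) auto
    moreover have "\<epsilon>\<^sup>2 * t\<^sup>2 \<le> 1 * t\<^sup>2"
      using t \<epsilon> by (intro mult_right_mono) auto
    ultimately have "(cmod c)\<^sup>2 * (\<epsilon>\<^sup>2 * t) + cmod c * K * (\<epsilon>\<^sup>2 * t\<^sup>2) \<le> (cmod c)\<^sup>2 * t\<^sup>2 + cmod c * K * t\<^sup>2"
      using assms by (intro add_mono mult_left_mono) auto
    then show ?thesis by (simp add: B_def algebra_simps power2_eq_square)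
  qed
  also have "\<dots> \<le> 1 / \<epsilon> + 4 * B * \<epsilon>\<^sup>2"
    using assms t by (intro ellipse_radius_estimate) (auto simp: B_def)
  finally show ?thesis .
qed

section \<open>Coefficients and area for a function with a simple pole\<close>

text \<open>\<open>\<kappa> (exp z) / exp z\<close> is the derivative of
  \<open>\<phi> (exp z) / exp z\<close>, and the coefficients of \<open>\<kappa>\<close> are those
  of \<open>\<phi>\<close> times n - 1. Bessel's inequality holds on each circle of radius
  \<open>exp s\<close>, which is below 1 because \<open>b < 0\<close>; integration in
  \<open>s\<close> removes one of the two factors n - 1.\<close>

lemma laurent_area_lower_bound:
  fixes \<phi> :: "complex \<Rightarrow> complex" and a b :: real
  defines "\<kappa> \<equiv> \<lambda>z. z * deriv \<phi> z - \<phi> z"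
  assumes hol: "\<phi> holomorphic_on \<D>" and ab: "a \<le> b" "b < 0"
  shows "pi * (\<Sum>n<N. (real n - 1) * (cmod (taylor_coeff \<phi> n))\<^sup>2 *
      (exp (2 * (real n - 1) * b) - exp (2 * (real n - 1) * a)))
    \<le> integral {a..b} (\<lambda>s. integral {0..2*pi}
          (\<lambda>t. (cmod (\<kappa> (exp (Complex s t)) / exp (Complex s t)))\<^sup>2))"
    (is "_ \<le> integral _ (\<lambda>s. integral _ (\<lambda>t. ?F s t))")
proof -
  have hol\<kappa>: "\<kappa> holomorphic_on \<D>"
    unfolding \<kappa>_def by (intro holomorphic_intros hol) auto
  have coeff: "taylor_coeff \<kappa> n = (of_nat n - 1) * taylor_coeff \<phi> n" for n
  proof -
    have "\<kappa> has_fps_expansion (fps_X * fps_deriv (Abs_fps (taylor_coeff \<phi>)) - Abs_fps (taylor_coeff \<phi>))"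
      unfolding \<kappa>_def
      by (intro fps_expansion_intros has_fps_expansion_taylor_coeff hol)
    from taylor_coeff_eq_fps_nth[OF this refl, of n] show ?thesis
      by (cases n) (simp_all add: algebra_simps)
  qed
  have F: "?F s t = exp (-2 * s) * (cmod (\<kappa> (of_real (exp s) * cis t)))\<^sup>2" for s t
  proof -
    have "exp (Complex s t) = of_real (exp s) * cis t" by (simp add: exp_eq_polar)
    moreover have "cmod (exp (Complex s t)) = exp s" by simp
    ultimately have "?F s t = (cmod (\<kappa> (of_real (exp s) * cis t)))\<^sup>2 / (exp s)\<^sup>2"
      by (simp only: norm_divide power_divide)
    moreover have "exp (-2 * s) = 1 / (exp s)\<^sup>2"
      by (simp add: exp_minus exp_double inverse_eq_divide)
    ultimately show ?thesis by simp
  qed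
  have inner: "2 * pi * (\<Sum>n<N. (real n - 1)\<^sup>2 * (cmod (taylor_coeff \<phi> n))\<^sup>2 * exp (2 * (real n - 1) * s))
      \<le> integral {0..2*pi} (?F s)" if "s \<in> {a..b}" for s
  proof -
    have s: "0 < exp s" "exp s < 1" using that ab by auto
    have "2 * pi * (\<Sum>n<N. (real n - 1)\<^sup>2 * (cmod (taylor_coeff \<phi> n))\<^sup>2 * exp (2 * (real n - 1) * s))
      = exp (-2 * s) * (2 * pi * (\<Sum>n<N. (cmod (taylor_coeff \<kappa> n))\<^sup>2 * exp s ^ (2 * n)))"
    proof -
      have "(cmod (of_nat n - 1 :: complex))\<^sup>2 = (real n - 1)\<^sup>2" for n
        by (metis norm_of_real of_real_diff of_real_of_nat_eq of_real_1 power2_abs)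
      moreover have "exp (2 * (real n - 1) * s) = exp (-2 * s) * exp s ^ (2 * n)" for n
        by (simp add: algebra_simps flip: exp_of_nat_mult exp_add)
      ultimately show ?thesis
        unfolding sum_distrib_left
        by (intro sum.cong) (auto simp: coeff norm_mult power_mult_distrib)
    qed
    also have "\<dots> \<le> exp (-2 * s) * circle_sqint (exp s) \<kappa>"
      by (intro mult_left_mono circle_sqint_bessel hol\<kappa> s) auto
    also have "\<dots> = integral {0..2*pi} (?F s)"
      unfolding F circle_sqint_def by (rule integral_mult_right[symmetric])
    finally show ?thesis .
  qed
  have "continuous_on (cbox (a, 0) (b, 2*pi)) (\<lambda>(s, t). exp (-2 * s) * (cmod (\<kappa> (of_real (exp s) * cis t)))\<^sup>2)"
    unfolding split_def
    by (intro continuous_intros continuous_on_compose2[OF holomorphic_on_imp_continuous_on[OF hol\<kappa>]])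
       (use ab in \<open>auto simp: cbox_Pair_eq norm_mult intro!: continuous_intros\<close>)
  from integral_integrable_2dim[OF this]
  have int: "(\<lambda>s. integral {0..2*pi} (?F s)) integrable_on {a..b}"
    by (simp add: F)
  have "((\<lambda>s. 2 * pi * (\<Sum>n<N. (real n - 1)\<^sup>2 * (cmod (taylor_coeff \<phi> n))\<^sup>2 * exp (2 * (real n - 1) * s)))
     has_integral
      (pi * (\<Sum>n<N. (real n - 1) * (cmod (taylor_coeff \<phi> n))\<^sup>2 * exp (2 * (real n - 1) * b)) -
       pi * (\<Sum>n<N. (real n - 1) * (cmod (taylor_coeff \<phi> n))\<^sup>2 * exp (2 * (real n - 1) * a)))) {a..b}"
  proof (rule fundamental_theorem_of_calculus[OF ab(1)])
    fix x
    \<comment> \<open>As the integrand carries the square of \<open>m\<close>, the antiderivative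
      has a factor \<open>m\<close> and no division occurs; this covers \<open>m = 0\<close>, the
      case n = 1.\<close>
    have "((\<lambda>s. m * D * exp (2 * m * s)) has_real_derivative 2 * (m\<^sup>2 * D * exp (2 * m * x))) (at x within {a..b})"
      for m D :: real
      by (auto intro!: derivative_eq_intros simp: power2_eq_square)
    then have "((\<lambda>s. pi * (\<Sum>n<N. (real n - 1) * (cmod (taylor_coeff \<phi> n))\<^sup>2 * exp (2 * (real n - 1) * s)))
        has_real_derivative
        pi * (\<Sum>n<N. 2 * ((real n - 1)\<^sup>2 * (cmod (taylor_coeff \<phi> n))\<^sup>2 * exp (2 * (real n - 1) * x))))
        (at x within {a..b})"
      by (intro DERIV_cmult DERIV_sum)
    then show "((\<lambda>s. pi * (\<Sum>n<N. (real n - 1) * (cmod (taylor_coeff \<phi> n))\<^sup>2 * exp (2 * (real n - 1) * s)))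
        has_vector_derivative
        2 * pi * (\<Sum>n<N. (real n - 1)\<^sup>2 * (cmod (taylor_coeff \<phi> n))\<^sup>2 * exp (2 * (real n - 1) * x)))
        (at x within {a..b})"
      by (simp only: has_real_derivative_iff_has_vector_derivative sum_distrib_left[symmetric]
          mult.assoc mult.left_commute[of pi 2])
  qed
  from has_integral_le[OF this integrable_integral[OF int] inner]
  show ?thesis
    by (simp add: right_diff_distrib sum_subtractf)
qed

text \<open>In logarithmic coordinates the annulus between the radii \<open>\<epsilon>\<close> and
  \<open>\<rho>\<close>, cut along a ray, is an open rectangle of height 2 pi on which
  \<open>G\<close> is injective. The area of its image is bounded below by coefficients and above by
  the containment of the ellipse, with \<open>q = c * \<epsilon>\<^sup>2\<close>.\<close>

lemma area_theorem_approx: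
  fixes \<phi> :: "complex \<Rightarrow> complex" and \<epsilon> \<rho> K :: real
  defines "c \<equiv> taylor_coeff \<phi> 2"
  defines "B \<equiv> K + cmod c * K + (cmod c)\<^sup>2"
  assumes hol: "\<phi> holomorphic_on \<D>" and inj: "inj_on (\<lambda>z. \<phi> z / z) (\<D> - {0})"
    and K: "0 \<le> K" "\<And>z. cmod z \<le> \<rho> \<Longrightarrow> cmod (\<phi> z - (1 + c * z\<^sup>2)) \<le> K * (cmod z) ^ 3"
    and \<rho>: "0 < \<epsilon>" "\<epsilon> < \<rho>" "\<rho> < 1" "4 * cmod c * \<epsilon> \<le> 1" "4 * B * \<epsilon> \<le> 1"
  shows "(1 - (cmod c * \<epsilon>\<^sup>2)\<^sup>2) * (\<Sum>n<N. (real n - 1) * (cmod (taylor_coeff \<phi> n))\<^sup>2 *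
      (exp (2 * (real n - 1) * ln \<rho>) - exp (2 * (real n - 1) * ln \<epsilon>))) \<le> (1 / \<epsilon> + (4 * B + 1) * \<epsilon>\<^sup>2)\<^sup>2"
proof -
  define \<kappa> where "\<kappa> = (\<lambda>z. z * deriv \<phi> z - \<phi> z)"
  define G where "G = (\<lambda>z. \<phi> (exp z) / exp z)"
  define G' where "G' = (\<lambda>z. \<kappa> (exp z) / exp z)"
  define R where "R = 1 / \<epsilon> + (4 * B + 1) * \<epsilon>\<^sup>2"
  define q where "q = c * of_real (\<epsilon>\<^sup>2)"
  have hol\<kappa>: "\<kappa> holomorphic_on \<D>"
    unfolding \<kappa>_def by (intro holomorphic_intros hol) auto
  have exp_disc: "exp z \<in> \<D>" if "Re z \<le> ln \<rho>" for z
  proof -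
    have "exp (Re z) \<le> \<rho>" using that \<rho> by (simp add: ln_ge_iff)
    then have "cmod (exp z) < 1" using \<rho> by (simp only: norm_exp_eq_Re)
    then show ?thesis by simp
  qed
  have B0: "0 \<le> B" using K by (simp add: B_def)
  have q1: "cmod q \<le> 1"
  proof -
    have "4 * cmod c * \<epsilon> * \<epsilon> \<le> 1 * 1"
      using \<rho> by (intro mult_mono) auto
    moreover have "0 \<le> cmod c * \<epsilon> * \<epsilon>" using \<rho> by simp
    ultimately show ?thesis by (simp add: q_def norm_mult power2_eq_square norm_power)
  qed
  have "(1 - (cmod q)\<^sup>2) * integral {ln \<epsilon>..ln \<rho>} (\<lambda>s. integral {0..2*pi} (\<lambda>t. (cmod (G' (Complex s t)))\<^sup>2))
      \<le> pi * R\<^sup>2"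
  proof (rule rectangle_area_bound)
    fix z assume "Re z \<in> {ln \<epsilon>..ln \<rho>}" "Im z \<in> {0..2*pi}"
    then have "(\<phi> has_field_derivative deriv \<phi> (exp z)) (at (exp z))"
      using exp_disc[of z] by (intro holomorphic_derivI[OF hol]) auto
    then show "(G has_field_derivative G' z) (at z)"
      unfolding G_def G'_def \<kappa>_def
      by (auto intro!: derivative_eq_intros DERIV_chain2[of \<phi>] simp: field_simps power2_eq_square)
  next
    show "continuous_on {z. Re z \<in> {ln \<epsilon>..ln \<rho>} \<and> Im z \<in> {0..2*pi}} G'"
      unfolding G'_def
      by (intro continuous_intros continuous_on_compose2[OF holomorphic_on_imp_continuous_on[OF hol\<kappa>]])
         (use exp_disc in auto)
  next
    show "inj_on G {z. Re z \<in> {ln \<epsilon><..<ln \<rho>} \<and> Im z \<in> {0<..<2*pi}}"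
    proof (rule inj_onI, clarify)
      fix z w assume z: "Re z \<in> {ln \<epsilon><..<ln \<rho>}" "Im z \<in> {0<..<2*pi}"
        and w: "Re w \<in> {ln \<epsilon><..<ln \<rho>}" "Im w \<in> {0<..<2*pi}" and "G z = G w"
      then have "exp z = exp w"
        using inj exp_disc[of z] exp_disc[of w] by (auto simp: G_def inj_on_def)
      moreover have "\<bar>Im z - Im w\<bar> < 2 * pi" using z w by auto
      ultimately show "z = w" using exp_complex_eqI by blast
    qed
  next
    fix z assume z: "Re z \<in> {ln \<epsilon><..<ln \<rho>}" "Im z \<in> {0<..<2*pi}"
    define x where "x = exp z"
    have x: "\<epsilon> \<le> cmod x" "cmod x \<le> \<rho>"
    proof -
      have "ln \<epsilon> \<le> Re z" "Re z \<le> ln \<rho>" using z by auto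
      then have "exp (ln \<epsilon>) \<le> exp (Re z)" "exp (Re z) \<le> exp (ln \<rho>)" by (simp_all only: exp_le_cancel_iff)
      then show "\<epsilon> \<le> cmod x" "cmod x \<le> \<rho>" using \<rho> by (simp_all add: x_def)
    qed
    have x0: "x \<noteq> 0" by (simp add: x_def)
    have "G z - (1 / x + c * x) = (\<phi> x - (1 + c * x\<^sup>2)) / x"
      using x0 by (simp add: G_def x_def field_simps power2_eq_square)
    also have "cmod \<dots> \<le> K * cmod x ^ 3 / cmod x"
      unfolding norm_divide using K(2)[OF x(2)] by (intro divide_right_mono) auto
    also have "\<dots> = K * (cmod x)\<^sup>2"
      using x0 by (simp add: power2_eq_square power3_eq_cube)
    finally have "cmod (G z - c * \<epsilon>\<^sup>2 * cnj (G z)) \<le> 1 / \<epsilon> + 4 * B * \<epsilon>\<^sup>2"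
      unfolding B_def using \<rho> K x
      by (intro ellipse_containment[where z = x]) (auto simp: B_def)
    \<comment> \<open>The extra \<open>\<epsilon>\<^sup>2\<close> in \<open>R\<close> makes the
      bound strict, as containment in an open disc demands.\<close>
    also have "\<dots> < R" using \<rho> by (simp add: R_def algebra_simps)
    finally show "cmod (G z - q * cnj (G z)) < R" by (simp add: q_def)
  qed (use q1 B0 \<rho> in \<open>auto simp: R_def\<close>)
  moreover have "pi * (\<Sum>n<N. (real n - 1) * (cmod (taylor_coeff \<phi> n))\<^sup>2 *
      (exp (2 * (real n - 1) * ln \<rho>) - exp (2 * (real n - 1) * ln \<epsilon>)))
     \<le> integral {ln \<epsilon>..ln \<rho>} (\<lambda>s. integral {0..2*pi} (\<lambda>t. (cmod (G' (Complex s t)))\<^sup>2))"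
    unfolding G'_def \<kappa>_def using \<rho> by (intro laurent_area_lower_bound hol) auto
  moreover have "0 \<le> 1 - (cmod q)\<^sup>2" using q1 by (simp add: power_le_one)
  ultimately have "(1 - (cmod q)\<^sup>2) * (pi * (\<Sum>n<N. (real n - 1) * (cmod (taylor_coeff \<phi> n))\<^sup>2 *
      (exp (2 * (real n - 1) * ln \<rho>) - exp (2 * (real n - 1) * ln \<epsilon>)))) \<le> pi * R\<^sup>2"
    by (meson mult_left_mono order_trans)
  then have "pi * ((1 - (cmod q)\<^sup>2) * (\<Sum>n<N. (real n - 1) * (cmod (taylor_coeff \<phi> n))\<^sup>2 *
      (exp (2 * (real n - 1) * ln \<rho>) - exp (2 * (real n - 1) * ln \<epsilon>)))) \<le> pi * R\<^sup>2"
    by (simp only: mult.left_commute)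
  then have "(1 - (cmod q)\<^sup>2) * (\<Sum>n<N. (real n - 1) * (cmod (taylor_coeff \<phi> n))\<^sup>2 *
      (exp (2 * (real n - 1) * ln \<rho>) - exp (2 * (real n - 1) * ln \<epsilon>))) \<le> R\<^sup>2"
    by (rule mult_left_le_imp_le) simp
  moreover have "cmod q = cmod c * \<epsilon>\<^sup>2" by (simp add: q_def norm_mult norm_power)
  ultimately show ?thesis by (simp add: R_def)
qed

text \<open>Gronwall's area theorem for \<open>\<phi> z / z\<close>: in the approximate inequality
  \<open>\<epsilon>\<close> tends to 0, then \<open>\<rho>\<close> tends to 1. The sum starts at 2
  because index 1 has weight 0, while index 0, the pole, has weight -1 and supplies the right-hand
  side.\<close>

theorem area_theorem:
  assumes hol: "\<phi> holomorphic_on \<D>" and inj: "inj_on (\<lambda>z. \<phi> z / z) (\<D> - {0})"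
    and \<phi>0: "\<phi> 0 = 1" and \<phi>1: "taylor_coeff \<phi> 1 = 0"
  shows "(\<Sum>n\<in>{2..<N}. (real n - 1) * (cmod (taylor_coeff \<phi> n))\<^sup>2) \<le> 1"
proof -
  consider "N < 2" | "2 \<le> N" by linarith
  then show ?thesis
  proof cases
    case 2
    define c where "c = taylor_coeff \<phi> 2"
    define d where "d n = (real n - 1) * (cmod (taylor_coeff \<phi> n))\<^sup>2" for n
    obtain S where S: "S holomorphic_on \<D>"
        "\<And>z. \<phi> z = (\<Sum>n<3. taylor_coeff \<phi> n * z ^ n) + z ^ 3 * S z"
      using holomorphic_taylor_remainder[OF hol] by blast
    have \<phi>_eq: "\<phi> z - (1 + c * z\<^sup>2) = z ^ 3 * S z" for z
      using S(2)[of z] \<phi>0 \<phi>1 by (simp add: numeral_3_eq_3 numeral_2_eq_2 c_def)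
    have sum_le: "(\<Sum>n\<in>{2..<N}. d n * \<rho> ^ (2 * (n - 1))) \<le> 1 / \<rho>\<^sup>2" if \<rho>: "0 < \<rho>" "\<rho> < 1" for \<rho>
    proof -
      \<comment> \<open>The resulting \<open>K\<close> does not depend on \<open>\<epsilon>\<close>,
        so \<open>\<epsilon>\<close> can tend to 0 with \<open>\<rho>\<close> fixed.\<close>
      have "compact (S ` cball 0 \<rho>)"
        using \<rho> by (intro compact_continuous_image
            continuous_on_subset[OF holomorphic_on_imp_continuous_on[OF S(1)]]) auto
      then obtain K where K: "K > 0" "\<And>z. z \<in> cball 0 \<rho> \<Longrightarrow> cmod (S z) \<le> K"
        using compact_imp_bounded bounded_pos[of "S ` cball 0 \<rho>"] by auto
      have K': "cmod (\<phi> z - (1 + c * z\<^sup>2)) \<le> K * cmod z ^ 3" if "cmod z \<le> \<rho>" for z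
        using K(2)[of z] that by (simp add: \<phi>_eq norm_mult norm_power mult.commute mult_right_mono)
      define B where "B = K + cmod c * K + (cmod c)\<^sup>2"
      define A where "A = 4 * B + 1"
      \<comment> \<open>\<open>\<epsilon> < 1 / M\<close> yields both smallness conditions of the
        approximate inequality; the summand 1 keeps \<open>M\<close> positive.\<close>
      define M where "M = 4 * cmod c + 4 * B + 1"
      have "0 \<le> B" using K by (simp add: B_def)
      then have M: "0 < M" "4 * cmod c \<le> M" "4 * B \<le> M"
        by (auto simp: M_def intro: add_nonneg_pos)
      \<comment> \<open>The pole contributes \<open>1 / \<epsilon>\<^sup>2\<close> on the left, the
        squared radius the same on the right. They cancel, and what remains on the right tends to
        0.\<close>
      have key: "(1 - (cmod c * \<epsilon>\<^sup>2)\<^sup>2) *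
          ((\<Sum>n\<in>{2..<N}. d n * (\<rho> ^ (2 * (n - 1)) - \<epsilon> ^ (2 * (n - 1)))) - 1 / \<rho>\<^sup>2)
          \<le> 2 * A * \<epsilon> + A\<^sup>2 * \<epsilon> ^ 4 + (cmod c)\<^sup>2 * \<epsilon>\<^sup>2" if \<epsilon>: "0 < \<epsilon>" "\<epsilon> < \<rho>" "\<epsilon> < 1 / M" for \<epsilon>
      proof -
        have M\<epsilon>: "M * \<epsilon> \<le> 1" using \<epsilon> M by (simp add: field_simps)
        have "4 * cmod c * \<epsilon> \<le> 1" "4 * B * \<epsilon> \<le> 1"
          using M\<epsilon> mult_right_mono[OF M(2), of \<epsilon>] mult_right_mono[OF M(3), of \<epsilon>] \<epsilon> by linarith+
        from area_theorem_approx[OF hol inj, of K \<rho> \<epsilon> N, folded c_def, folded B_def,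
            OF _ K' \<epsilon>(1,2) \<rho>(2) this] K(1)
        have "(1 - (cmod c * \<epsilon>\<^sup>2)\<^sup>2) * (\<Sum>n<N. d n *
            (exp (2 * (real n - 1) * ln \<rho>) - exp (2 * (real n - 1) * ln \<epsilon>))) \<le> (1 / \<epsilon> + A * \<epsilon>\<^sup>2)\<^sup>2"
          by (simp add: d_def A_def)
        also have "(\<Sum>n<N. d n * (exp (2 * (real n - 1) * ln \<rho>) - exp (2 * (real n - 1) * ln \<epsilon>))) =
            (\<Sum>n\<in>{2..<N}. d n * (\<rho> ^ (2 * (n - 1)) - \<epsilon> ^ (2 * (n - 1)))) + (1 / \<epsilon>\<^sup>2 - 1 / \<rho>\<^sup>2)"
        proof -
          have pow: "exp (2 * (real n - 1) * ln x) = x ^ (2 * (n - 1))" if "2 \<le> n" "0 < x" for n x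
          proof -
            have "2 * (real n - 1) * ln x = real (2 * (n - 1)) * ln x"
              using that by (simp add: of_nat_diff)
            then show ?thesis using that by (simp only: exp_of_nat_mult exp_ln)
          qed
          have inv: "exp (- (2 * ln x)) = 1 / x\<^sup>2" if "0 < x" for x :: real
            using that by (simp add: exp_minus exp_double inverse_eq_divide)
          \<comment> \<open>The first two indices are separated: \<open>d 0 = -1\<close> yields
            \<open>1 / \<epsilon>\<^sup>2 - 1 / \<rho>\<^sup>2\<close>, and
            \<open>d 1 = 0\<close>.\<close>
          have "{..<N} = insert 0 (insert 1 {2..<N})" using 2 by auto
          then have tot: "(\<Sum>n<N. h n) = h 0 + h 1 + (\<Sum>n\<in>{2..<N}. h n)" for h :: "nat \<Rightarrow> real"
            by simp
          have "(\<Sum>n\<in>{2..<N}. d n * (exp (2 * (real n - 1) * ln \<rho>) - exp (2 * (real n - 1) * ln \<epsilon>))) =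
              (\<Sum>n\<in>{2..<N}. d n * (\<rho> ^ (2 * (n - 1)) - \<epsilon> ^ (2 * (n - 1))))"
          proof (rule sum.cong)
            fix n assume "n \<in> {2..<N}"
            then have "2 \<le> n" by simp
            from pow[OF this \<rho>(1)] pow[OF this \<epsilon>(1)]
            show "d n * (exp (2 * (real n - 1) * ln \<rho>) - exp (2 * (real n - 1) * ln \<epsilon>)) =
                d n * (\<rho> ^ (2 * (n - 1)) - \<epsilon> ^ (2 * (n - 1)))"
              by (simp only:)
          qed simp
          then show ?thesis
            unfolding tot using \<rho> \<epsilon> \<phi>0 by (simp add: d_def inv)
        qed
        finally have "(1 - (cmod c * \<epsilon>\<^sup>2)\<^sup>2) *
            ((\<Sum>n\<in>{2..<N}. d n * (\<rho> ^ (2 * (n - 1)) - \<epsilon> ^ (2 * (n - 1)))) + (1 / \<epsilon>\<^sup>2 - 1 / \<rho>\<^sup>2))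
            \<le> (1 / \<epsilon> + A * \<epsilon>\<^sup>2)\<^sup>2" .
        moreover have "(1 / \<epsilon> + A * \<epsilon>\<^sup>2)\<^sup>2 = 1 / \<epsilon>\<^sup>2 + 2 * A * \<epsilon> + A\<^sup>2 * \<epsilon> ^ 4"
          using \<epsilon> by (simp add: field_simps power2_eq_square power4_eq_xxxx)
        moreover have "(1 - (cmod c * \<epsilon>\<^sup>2)\<^sup>2) * (1 / \<epsilon>\<^sup>2) = 1 / \<epsilon>\<^sup>2 - (cmod c)\<^sup>2 * \<epsilon>\<^sup>2"
          using \<epsilon> by (simp add: field_simps power2_eq_square)
        ultimately show ?thesis
          by (simp only: right_diff_distrib distrib_left)
      qed
      have "((\<lambda>\<epsilon>. (1 - (cmod c * \<epsilon>\<^sup>2)\<^sup>2) *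
          ((\<Sum>n\<in>{2..<N}. d n * (\<rho> ^ (2 * (n - 1)) - \<epsilon> ^ (2 * (n - 1)))) - 1 / \<rho>\<^sup>2)) \<longlongrightarrow>
          (1 - (cmod c * 0\<^sup>2)\<^sup>2) *
          ((\<Sum>n\<in>{2..<N}. d n * (\<rho> ^ (2 * (n - 1)) - 0 ^ (2 * (n - 1)))) - 1 / \<rho>\<^sup>2)) (at_right 0)"
        by (intro tendsto_intros)
      moreover have "((\<lambda>\<epsilon>. 2 * A * \<epsilon> + A\<^sup>2 * \<epsilon> ^ 4 + (cmod c)\<^sup>2 * \<epsilon>\<^sup>2) \<longlongrightarrow>
          2 * A * 0 + A\<^sup>2 * 0 ^ 4 + (cmod c)\<^sup>2 * 0\<^sup>2) (at_right 0)"
        by (intro tendsto_intros)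
      moreover have "\<forall>\<^sub>F \<epsilon> in at_right 0. (1 - (cmod c * \<epsilon>\<^sup>2)\<^sup>2) *
          ((\<Sum>n\<in>{2..<N}. d n * (\<rho> ^ (2 * (n - 1)) - \<epsilon> ^ (2 * (n - 1)))) - 1 / \<rho>\<^sup>2)
          \<le> 2 * A * \<epsilon> + A\<^sup>2 * \<epsilon> ^ 4 + (cmod c)\<^sup>2 * \<epsilon>\<^sup>2"
        unfolding eventually_at_right_field
        using key M \<rho> by (intro exI[of _ "min \<rho> (1 / M)"]) auto
      ultimately have "(1 - (cmod c * 0\<^sup>2)\<^sup>2) *
          ((\<Sum>n\<in>{2..<N}. d n * (\<rho> ^ (2 * (n - 1)) - 0 ^ (2 * (n - 1)))) - 1 / \<rho>\<^sup>2)
          \<le> 2 * A * 0 + A\<^sup>2 * 0 ^ 4 + (cmod c)\<^sup>2 * 0\<^sup>2"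
        by (intro tendsto_le[of "at_right (0::real)"]) auto
      moreover have "(\<Sum>n\<in>{2..<N}. d n * (\<rho> ^ (2 * (n - 1)) - 0 ^ (2 * (n - 1)))) =
          (\<Sum>n\<in>{2..<N}. d n * \<rho> ^ (2 * (n - 1)))"
        by (intro sum.cong) auto
      ultimately show ?thesis by simp
    qed
    have "((\<lambda>\<rho>. \<Sum>n\<in>{2..<N}. d n * \<rho> ^ (2 * (n - 1))) \<longlongrightarrow> (\<Sum>n\<in>{2..<N}. d n * 1 ^ (2 * (n - 1)))) (at_left 1)"
      by (intro tendsto_intros)
    moreover have "((\<lambda>\<rho>::real. 1 / \<rho>\<^sup>2) \<longlongrightarrow> 1 / 1\<^sup>2) (at_left 1)"
      by (intro tendsto_intros) auto
    moreover have "\<forall>\<^sub>F \<rho> in at_left 1. (\<Sum>n\<in>{2..<N}. d n * \<rho> ^ (2 * (n - 1))) \<le> 1 / \<rho>\<^sup>2"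
      unfolding eventually_at_left_field using sum_le by (intro exI[of _ 0]) auto
    ultimately have "(\<Sum>n\<in>{2..<N}. d n * 1 ^ (2 * (n - 1))) \<le> 1 / 1\<^sup>2"
      by (intro tendsto_le[of "at_left (1::real)"]) auto
    then show ?thesis by (simp add: d_def)
  qed simp
qed

section \<open>Coefficients of odd univalent functions\<close>

lemma sum_power_over_odd_le:
  "(\<Sum>j\<in>{1..m}. (2/3) ^ j / (2 * real j - 1)) \<le> (1::real)"
proof -
  \<comment> \<open>From the third term on the denominators are at least 5. The subtracted quantity
    is the full geometric tail with denominator 5, which makes the bound inductive from
    \<open>m = 2\<close>.\<close>
  have *: "(\<Sum>j\<in>{1..m}. (2/3) ^ j / (2 * real j - 1)) \<le> 1 - 3/5 * (2/3) ^ Suc m" if "2 \<le> m" for m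
    using that
  proof (induction m rule: dec_induct)
    case base
    have "{1..2::nat} = {1, 2}" by auto
    then show ?case by (simp add: eval_nat_numeral)
  next
    case (step m)
    have "(2/3) ^ Suc m / (2 * real (Suc m) - 1) \<le> (2/3) ^ Suc m / (5::real)"
      using step.hyps by (intro divide_left_mono) auto
    then show ?case using step.IH by simp
  qed
  consider "m = 0" | "m = 1" | "2 \<le> m" by linarith
  then show ?thesis
  proof cases
    case 3
    have "(0::real) \<le> 3/5 * (2/3) ^ Suc m" by simp
    with *[OF 3] show ?thesis by linarith
  qed auto
qed

text \<open>\<open>\<alpha>\<close> and \<open>p\<close> stand for the moduli of the coefficients of
  a series and of its reciprocal. For \<open>s = sqrt (2/3)\<close> the area bound and AM-GM show
  that the sums of \<open>p j * s ^ j\<close> are at most 1; the recursion then propagates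
  \<open>\<alpha> m * s ^ m \<le> 1\<close>.\<close>

lemma inverse_series_coeff_bound:
  fixes p \<alpha> :: "nat \<Rightarrow> real"
  assumes "\<And>j. 0 \<le> p j" and "\<And>m. (\<Sum>j\<in>{1..m}. (2 * real j - 1) * (p j)\<^sup>2) \<le> 1"
    and "\<alpha> 0 \<le> 1" and rec: "\<And>m. 0 < m \<Longrightarrow> \<alpha> m \<le> (\<Sum>j\<in>{1..m}. p j * \<alpha> (m - j))"
  shows "\<alpha> m \<le> sqrt (3/2) ^ m"
proof -
  define s where "s = sqrt (2/3)"
  have s: "0 < s" "s\<^sup>2 = 2/3" "sqrt (3/2) = 1 / s"
    unfolding s_def by (simp, rule real_sqrt_pow2, simp, simp add: real_sqrt_divide)
  have ps: "(\<Sum>j\<in>{1..m}. p j * s ^ j) \<le> 1" for m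
  proof -
    have "p j * s ^ j \<le> ((2 * real j - 1) * (p j)\<^sup>2 + (2/3) ^ j / (2 * real j - 1)) / 2" if "j \<in> {1..m}" for j
    proof -
      have x: "0 < 2 * real j - 1" using that by auto
      \<comment> \<open>Splitting \<open>p j * s ^ j\<close> as
        \<open>(y * p j) * (s ^ j / y)\<close> makes AM-GM produce the area term and the term of the
        numerical series.\<close>
      define y where "y = sqrt (2 * real j - 1)"
      have y: "0 < y" "y\<^sup>2 = 2 * real j - 1" using x by (auto simp: y_def)
      have "0 \<le> (y * p j - s ^ j / y)\<^sup>2" by simp
      also have "\<dots> = y\<^sup>2 * (p j)\<^sup>2 + (s\<^sup>2) ^ j / y\<^sup>2 - 2 * (p j * s ^ j)"
        using y(1) by (simp add: power2_diff power_mult_distrib power_divide power_commutes flip: power_mult)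
          (simp add: mult.commute)
      finally show ?thesis by (simp add: y s)
    qed
    then have "(\<Sum>j\<in>{1..m}. p j * s ^ j) \<le>
        (\<Sum>j\<in>{1..m}. ((2 * real j - 1) * (p j)\<^sup>2 + (2/3) ^ j / (2 * real j - 1)) / 2)"
      by (rule sum_mono)
    also have "\<dots> = ((\<Sum>j\<in>{1..m}. (2 * real j - 1) * (p j)\<^sup>2) + (\<Sum>j\<in>{1..m}. (2/3) ^ j / (2 * real j - 1))) / 2"
      by (simp add: sum.distrib flip: sum_divide_distrib)
    also have "\<dots> \<le> 1" using assms(2)[of m] sum_power_over_odd_le[of m] by simp
    finally show ?thesis .
  qed
  show ?thesis
  proof (induction m rule: less_induct)
    case (less m)
    show ?case
    proof (cases "m = 0")
      case False
      have "\<alpha> m \<le> (\<Sum>j\<in>{1..m}. p j * \<alpha> (m - j))" using False rec by simp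
      also have "\<dots> \<le> (\<Sum>j\<in>{1..m}. p j * (1 / s) ^ (m - j))"
        using less assms(1) s(3) by (intro sum_mono mult_left_mono) auto
      also have "\<dots> = (\<Sum>j\<in>{1..m}. p j * s ^ j) * (1 / s) ^ m"
        unfolding sum_distrib_right using s(1)
        by (intro sum.cong) (auto simp: power_divide power_diff)
      also have "\<dots> \<le> 1 * (1 / s) ^ m"
        using ps[of m] s(1) by (intro mult_right_mono) auto
      finally show ?thesis by (simp add: s(3))
    qed (use assms in simp)
  qed
qed

text \<open>In \<open>f z = z * k z\<close>, injectivity makes \<open>k\<close> zero-free and
  oddness makes it even. So \<open>\<phi> = 1 / k\<close> is holomorphic, and
  \<open>\<phi> z / z = 1 / f z\<close> is injective off 0, as the area theorem requires. The Cauchy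
  product of \<open>\<phi>\<close> and \<open>k\<close> transfers the bounds to the coefficients of
  \<open>k\<close>, which are those of \<open>f\<close> shifted by one.\<close>

lemma odd_univalent_coeff_bounds:
  fixes f :: "complex \<Rightarrow> complex"
  assumes hol: "f holomorphic_on \<D>" and inj: "inj_on f \<D>"
    and odd: "\<forall>z\<in>\<D>. f (- z) = - f z" and f0: "f 0 = 0" and f'0: "deriv f 0 = 1"
  shows "even n \<Longrightarrow> taylor_coeff f n = 0" "taylor_coeff f 1 = 1"
    "cmod (taylor_coeff f 3) \<le> 1" "(cmod (taylor_coeff f (2 * m + 1)))\<^sup>2 \<le> (3/2) ^ m"
proof -
  obtain k where k: "k holomorphic_on \<D>" "\<And>z. f z = f 0 + z * k z" "k 0 = deriv f 0"
      "\<And>n. taylor_coeff f (Suc n) = taylor_coeff k n"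
    using holomorphic_split_zero[OF hol] by metis
  have fk: "f z = z * k z" for z using k(2)[of z] f0 by simp
  have k0: "k 0 = 1" using k(3) f'0 by simp
  have k_nz: "k z \<noteq> 0" if "z \<in> \<D>" for z
  proof (cases "z = 0")
    case False
    then have "f z \<noteq> f 0" using inj that by (auto simp: inj_on_def)
    then show ?thesis using fk f0 by auto
  qed (simp add: k0)
  have k_even: "k (- z) = k z" if "z \<in> \<D>" for z
    using odd that fk[of z] fk[of "- z"] by (cases "z = 0") auto
  define \<phi> where "\<phi> = (\<lambda>z. inverse (k z))"
  have hol\<phi>: "\<phi> holomorphic_on \<D>"
    unfolding \<phi>_def by (intro holomorphic_intros k k_nz)
  have k_odd_coeff: "taylor_coeff k n = 0" if "odd n" for n
    by (rule taylor_coeff_symmetric[OF k(1) k_even that])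
  have \<phi>_odd_coeff: "taylor_coeff \<phi> n = 0" if "odd n" for n
    by (rule taylor_coeff_symmetric[OF hol\<phi> _ that]) (use k_even in \<open>auto simp: \<phi>_def\<close>)
  have inj\<phi>: "inj_on (\<lambda>z. \<phi> z / z) (\<D> - {0})"
  proof (rule inj_onI)
    fix z w assume zw: "z \<in> \<D> - {0}" "w \<in> \<D> - {0}" "\<phi> z / z = \<phi> w / w"
    then have "inverse (f z) = inverse (f w)"
      by (simp add: \<phi>_def fk field_simps)
    then show "z = w" using inj zw by (auto simp: inj_on_def)
  qed
  have conv: "(\<Sum>i\<le>n. taylor_coeff \<phi> i * taylor_coeff k (n - i)) = 0" if "0 < n" for n
  proof -
    have "(\<lambda>z. \<phi> z * k z) has_fps_expansion Abs_fps (taylor_coeff \<phi>) * Abs_fps (taylor_coeff k)"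
      by (intro has_fps_expansion_mult has_fps_expansion_taylor_coeff hol\<phi> k)
    from taylor_coeff_eq_fps_nth[OF this, of "\<lambda>_. 1" n]
    have "taylor_coeff (\<lambda>_. 1) n = (\<Sum>i\<le>n. taylor_coeff \<phi> i * taylor_coeff k (n - i))"
      using k_nz by (simp add: \<phi>_def fps_mult_nth atMost_atLeast0)
    moreover have "taylor_coeff (\<lambda>_. 1) n = fps_nth 1 n"
      by (rule taylor_coeff_eq_fps_nth[OF has_fps_expansion_1]) simp
    ultimately show ?thesis using that by simp
  qed
  define p where "p j = cmod (taylor_coeff \<phi> (2 * j))" for j
  define \<alpha> where "\<alpha> m = cmod (taylor_coeff k (2 * m))" for m
  have area: "(\<Sum>j\<in>{1..m}. (2 * real j - 1) * (p j)\<^sup>2) \<le> 1" for m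
  proof -
    have "(\<Sum>j\<in>{1..m}. (2 * real j - 1) * (p j)\<^sup>2) =
        (\<Sum>n\<in>(\<lambda>j. 2 * j) ` {1..m}. (real n - 1) * (cmod (taylor_coeff \<phi> n))\<^sup>2)"
      by (subst sum.reindex) (auto simp: inj_on_def p_def)
    also have "\<dots> \<le> (\<Sum>n\<in>{2..<2*m+1}. (real n - 1) * (cmod (taylor_coeff \<phi> n))\<^sup>2)"
      by (intro sum_mono2) auto
    also have "\<dots> \<le> 1"
      by (rule area_theorem[OF hol\<phi> inj\<phi>]) (auto simp: \<phi>_def k0 intro: \<phi>_odd_coeff[unfolded \<phi>_def])
    finally show ?thesis .
  qed
  have rec: "\<alpha> m \<le> (\<Sum>j\<in>{1..m}. p j * \<alpha> (m - j))" if "0 < m" for m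
  proof -
    have "(\<Sum>i\<le>2*m. taylor_coeff \<phi> i * taylor_coeff k (2 * m - i)) =
        (\<Sum>i\<in>(\<lambda>j. 2 * j) ` {..m}. taylor_coeff \<phi> i * taylor_coeff k (2 * m - i))"
    proof (rule sum.mono_neutral_right)
      show "\<forall>i\<in>{..2*m} - (\<lambda>j. 2 * j) ` {..m}. taylor_coeff \<phi> i * taylor_coeff k (2 * m - i) = 0"
      proof
        fix i assume i: "i \<in> {..2*m} - (\<lambda>j. 2 * j) ` {..m}"
        have "odd i"
        proof
          assume "even i"
          then obtain j where "i = 2 * j" by auto
          with i show False by auto
        qed
        then show "taylor_coeff \<phi> i * taylor_coeff k (2 * m - i) = 0" by (simp add: \<phi>_odd_coeff)
      qed
    qed auto
    also have "\<dots> = (\<Sum>j\<le>m. taylor_coeff \<phi> (2 * j) * taylor_coeff k (2 * (m - j)))"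
      by (subst sum.reindex) (auto simp: inj_on_def right_diff_distrib')
    also have "{..m} = insert 0 {1..m}" by auto
    finally have "taylor_coeff k (2 * m) = - (\<Sum>j\<in>{1..m}. taylor_coeff \<phi> (2 * j) * taylor_coeff k (2 * (m - j)))"
      using conv[of "2 * m"] that by (simp add: \<phi>_def k0 add_eq_0_iff2)
    then show ?thesis
      unfolding \<alpha>_def p_def by (simp add: norm_mult[symmetric] norm_sum)
  qed
  have \<alpha>0: "\<alpha> 0 \<le> 1" by (simp add: \<alpha>_def k0)
  show "taylor_coeff f n = 0" if "even n"
    using that k(4) k_odd_coeff f0 by (cases n) auto
  show "taylor_coeff f 1 = 1"
    using k(4)[of 0] k0 by simp
  \<comment> \<open>The first term of the area sum gives \<open>p 1 \<le> 1\<close>; the general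
    bound would give only \<open>sqrt (3/2)\<close>.\<close>
  show "cmod (taylor_coeff f 3) \<le> 1"
  proof -
    have "(p 1)\<^sup>2 \<le> 1" using area[of 1] by simp
    then have "p 1 \<le> 1" using abs_le_square_iff[of "p 1" 1] by simp
    moreover have "\<alpha> 1 \<le> p 1" using rec[of 1] by (simp add: \<alpha>_def k0)
    ultimately show ?thesis using k(4)[of 2] by (simp add: \<alpha>_def numeral_3_eq_3 numeral_2_eq_2)
  qed
  have "\<alpha> m \<le> sqrt (3/2) ^ m"
    by (rule inverse_series_coeff_bound[OF _ area \<alpha>0 rec]) (auto simp: p_def)
  then have "(\<alpha> m)\<^sup>2 \<le> (sqrt (3/2) ^ m)\<^sup>2"
    by (intro power_mono) (auto simp: \<alpha>_def)
  also have "\<dots> = (3/2) ^ m"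
    by (simp add: real_sqrt_power[symmetric])
  finally show "(cmod (taylor_coeff f (2 * m + 1)))\<^sup>2 \<le> (3/2) ^ m"
    using k(4)[of "2 * m"] by (simp add: \<alpha>_def)
qed

section \<open>Weighted estimate of the majorant series\<close>

text \<open>Summation by parts, as an induction on a stronger bound: the weighted sum is at least
  \<open>q K\<close> times the plain one. The weight \<open>q K\<close> lies one past the last index
  summed.\<close>

lemma weighted_sum_nonneg:
  fixes q d :: "nat \<Rightarrow> real"
  assumes "\<And>K. 0 \<le> sum d {..<K}" "\<And>k. 0 \<le> q k" "\<And>k. q (Suc k) \<le> q k"
  shows "0 \<le> (\<Sum>k<K. q k * d k)"
proof -
  have "q K * sum d {..<K} \<le> (\<Sum>k<K. q k * d k)" for K
  proof (induction K)
    case (Suc K)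
    have "q (Suc K) * sum d {..<Suc K} \<le> q K * sum d {..<Suc K}"
      by (intro mult_right_mono assms)
    then show ?case using Suc by (simp add: algebra_simps)
  qed simp
  moreover have "0 \<le> q K * sum d {..<K}" using assms by simp
  ultimately show ?thesis by (meson order_trans)
qed

text \<open>111/200 lies just to the right of the root near 0.554958. \<open>F\<close> changes sign
  between 0 and 111/200; the root found there is positive because \<open>F 0 = -1\<close>, and it
  bounds the infimum from above.\<close>

lemma r_star_le: "r_star \<le> 111/200"
proof -
  define F where "F = (\<lambda>x::real. x^2 - (1 - x)^2 * (1 + x))"
  have "\<exists>x\<ge>0. x \<le> 111/200 \<and> F x = 0"
    by (rule IVT') (auto simp: F_def power2_eq_square intro!: continuous_intros)
  then obtain x where x: "0 \<le> x" "x \<le> 111/200" "F x = 0" by blast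
  then have "x \<noteq> 0" by (auto simp: F_def)
  with x have "x \<in> {x::real. 0 < x \<and> x^2 = (1 - x)^2 * (1 + x)}"
    by (auto simp: F_def)
  then have "r_star \<le> x"
    unfolding r_star_def by (rule cInf_lower) (auto intro!: bdd_belowI[of _ 0])
  with x show ?thesis by simp
qed

lemma majorant_partial_sum_le:
  fixes a b :: "nat \<Rightarrow> real" and r :: real
  assumes rog: "\<And>N. (\<Sum>n<N. (b n)\<^sup>2) \<le> (\<Sum>n<N. (a n)\<^sup>2)"
    and a: "\<And>n. even n \<Longrightarrow> a n = 0" "a 1 = 1" "(a 3)\<^sup>2 \<le> 1" "\<And>m. (a (2 * m + 1))\<^sup>2 \<le> (3/2) ^ m"
    and b: "b 0 = 0" and r: "0 \<le> r" "r \<le> 111/200"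
  shows "(\<Sum>n<2*K+1. b n * r ^ n) \<le> 1"
proof -
  define u where "u = r\<^sup>2"
  define U where "U = (111/200::real)\<^sup>2"
  \<comment> \<open>\<open>\<theta>\<close> approximates the optimal constant in \<open>x y \<le> (\<theta> x\<^sup>2 + y\<^sup>2 / \<theta>) / 2\<close> for the two sums below.\<close>
  define \<theta> where "\<theta> = (73/125::real)"
  have u: "0 \<le> u" "u \<le> U"
    using r unfolding u_def U_def by (auto intro: power_mono)
  have U: "U = 12321/40000" by (simp add: U_def power2_eq_square)
  have geom: "(\<Sum>k<K. x ^ k) \<le> 1 / (1 - x)" if "0 \<le> x" "x < 1" for x :: real
    using that by (simp add: sum_gp_strict divide_right_mono)
  define \<beta> where "\<beta> k = (b (2*k+1))\<^sup>2 + (b (2*k+2))\<^sup>2" for k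
  have odd_sum: "(\<Sum>n<2*K+1. h n) = h 0 + (\<Sum>k<K. h (2*k+1) + h (2*k+2))" for h :: "nat \<Rightarrow> real" and K
    by (induction K) (simp_all add: algebra_simps)
  \<comment> \<open>The length \<open>2*K+1\<close> completes the last pair, and in each pair of the
    \<open>a\<close> only the odd index survives.\<close>
  have "(\<Sum>k<K. \<beta> k) \<le> (\<Sum>k<K. (a (2*k+1))\<^sup>2)" for K
    using rog[of "2*K+1"] b a(1) unfolding odd_sum \<beta>_def by simp
  then have "0 \<le> (\<Sum>k<K. u ^ k * ((a (2*k+1))\<^sup>2 - \<beta> k))"
    using u U by (intro weighted_sum_nonneg)
      (auto simp: sum_subtractf mult_left_le_one_le)
  then have 1: "(\<Sum>k<K. u ^ k * \<beta> k) \<le> (\<Sum>k<K. u ^ k * (a (2*k+1))\<^sup>2)"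
    by (simp add: right_diff_distrib sum_subtractf)
  have 2: "(\<Sum>k<K. u ^ k * (a (2*k+1))\<^sup>2) \<le> 1 + U + (3/2*U)\<^sup>2 / (1 - 3/2*U)"
  proof -
    \<comment> \<open>Two terms are added so that those at \<open>k = 0\<close> and
      \<open>k = 1\<close> can be split off and bounded by 1 and \<open>U\<close>; the other
      \<open>K\<close> are dominated by a geometric series of ratio \<open>3/2*U\<close>, about
      0.462.\<close>
    have "(\<Sum>k<K. u ^ k * (a (2*k+1))\<^sup>2) \<le> (\<Sum>k<Suc (Suc K). u ^ k * (a (2*k+1))\<^sup>2)"
      using u by (intro sum_mono2) auto
    also have "\<dots> = 1 + u * (a 3)\<^sup>2 + (\<Sum>k<K. u ^ (k+2) * (a (2*(k+2)+1))\<^sup>2)"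
      using a(2) by (simp add: sum.lessThan_Suc_shift numeral_3_eq_3 del: sum.lessThan_Suc)
    also have "\<dots> \<le> 1 + U * 1 + (\<Sum>k<K. (3/2*U)\<^sup>2 * (3/2*U) ^ k)"
    proof -
      have "u ^ (k+2) * (a (2*(k+2)+1))\<^sup>2 \<le> (3/2*U)\<^sup>2 * (3/2*U) ^ k" for k
      proof -
        have "u ^ (k+2) * (a (2*(k+2)+1))\<^sup>2 \<le> U ^ (k+2) * (3/2) ^ (k+2)"
          using u a(4)[of "k+2"] by (intro mult_mono power_mono) (auto simp: U_def)
        also have "\<dots> = (3/2*U) ^ (2 + k)"
          by (simp only: power_mult_distrib[symmetric] mult.commute[of U] add.commute[of k])
        also have "\<dots> = (3/2*U)\<^sup>2 * (3/2*U) ^ k"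
          by (rule power_add)
        finally show ?thesis .
      qed
      then have "(\<Sum>k<K. u ^ (k+2) * (a (2*(k+2)+1))\<^sup>2) \<le> (\<Sum>k<K. (3/2*U)\<^sup>2 * (3/2*U) ^ k)"
        by (rule sum_mono)
      moreover have "u * (a 3)\<^sup>2 \<le> U * 1"
        using u a(3) by (intro mult_mono) auto
      ultimately show ?thesis by simp
    qed
    also have "(\<Sum>k<K. (3/2*U)\<^sup>2 * (3/2*U) ^ k) \<le> (3/2*U)\<^sup>2 * (1 / (1 - 3/2*U))"
      unfolding sum_distrib_left[symmetric] by (intro mult_left_mono geom) (auto simp: U)
    finally show ?thesis by simp
  qed
  have 3: "(\<Sum>k<K. u ^ (k+1) + u ^ (k+2)) \<le> (U + U\<^sup>2) / (1 - U)"
  proof -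
    have "(\<Sum>k<K. u ^ (k+1) + u ^ (k+2)) \<le> (\<Sum>k<K. U ^ (k+1) + U ^ (k+2))"
      using u by (intro sum_mono add_mono power_mono)
    also have "\<dots> = (U + U\<^sup>2) * (\<Sum>k<K. U ^ k)"
      by (simp add: sum_distrib_left power2_eq_square algebra_simps sum.distrib)
    also have "\<dots> \<le> (U + U\<^sup>2) * (1 / (1 - U))"
      by (intro mult_left_mono geom) (auto simp: U)
    finally show ?thesis by simp
  qed
  \<comment> \<open>AM-GM with parameter \<open>\<theta>\<close>; \<open>l = k+1\<close> and
    \<open>l = k+2\<close> give the two members of a pair the same weight
    \<open>u ^ k\<close>.\<close>
  have summand: "x * (r ^ k * r ^ l) \<le> (\<theta> * (u ^ k * x\<^sup>2) + u ^ l / \<theta>) / 2" for x k l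
  proof -
    have "0 \<le> (\<theta> * (r ^ k * x) - r ^ l)\<^sup>2" by simp
    then have "2 * \<theta> * (x * (r ^ k * r ^ l)) \<le> \<theta>\<^sup>2 * (r ^ k * x)\<^sup>2 + (r ^ l)\<^sup>2"
      by (simp add: power2_diff power_mult_distrib algebra_simps)
    then show ?thesis
      by (simp add: \<theta>_def u_def field_simps power_mult_distrib flip: power_mult)
  qed
  have "(\<Sum>n<2*K+1. b n * r ^ n) = (\<Sum>k<K. b (2*k+1) * (r ^ k * r ^ (k+1)) + b (2*k+2) * (r ^ k * r ^ (k+2)))"
  proof -
    have "r ^ (2*k) = r ^ k * r ^ k" for k
      by (simp add: mult_2 power_add)
    then show ?thesis using odd_sum[of "\<lambda>n. b n * r ^ n" K] b by (simp add: mult.left_commute)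
  qed
  also have "\<dots> \<le> (\<Sum>k<K. (\<theta> * (u ^ k * (b (2*k+1))\<^sup>2) + u ^ (k+1) / \<theta>) / 2 +
      (\<theta> * (u ^ k * (b (2*k+2))\<^sup>2) + u ^ (k+2) / \<theta>) / 2)"
    by (intro sum_mono add_mono summand)
  also have "\<dots> = (\<theta> * (\<Sum>k<K. u ^ k * \<beta> k) + (\<Sum>k<K. u ^ (k+1) + u ^ (k+2)) / \<theta>) / 2"
    unfolding \<beta>_def
    by (simp add: sum.distrib sum_distrib_left sum_divide_distrib add_divide_distrib algebra_simps)
  also have "\<dots> \<le> (\<theta> * (1 + U + (3/2*U)\<^sup>2 / (1 - 3/2*U)) + ((U + U\<^sup>2) / (1 - U)) / \<theta>) / 2"
    using 1 2 3 by (intro divide_right_mono add_mono mult_left_mono) (auto simp: \<theta>_def)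
  \<comment> \<open>The left-hand side is about 0.9963.\<close>
  also have "\<dots> \<le> 1"
    by (simp add: U \<theta>_def power2_eq_square)
  finally show ?thesis .
qed

theorem theorem2:
  fixes f g :: "complex \<Rightarrow> complex"
  assumes f_holo: "f holomorphic_on ball 0 1"
    and f_univ: "inj_on f (ball 0 1)"
    and f_odd: "\<forall>z\<in>ball 0 1. f (- z) = - f z"
    and f0: "f 0 = 0"
    and f'0: "deriv f 0 = 1"
    and g_holo: "g holomorphic_on ball 0 1"
    and g0: "g 0 = 0"
    and sub: "subordinate g f"
  shows "\<forall>r. 0 \<le> r \<and> r \<le> r_star \<longrightarrow>
           summable (\<lambda>n. norm (taylor_coeff g n) * r ^ n) \<and> majorant g r \<le> 1"
proof (intro allI impI)
  fix r assume "0 \<le> r \<and> r \<le> r_star"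
  then have r: "0 \<le> r" "r \<le> 111/200" using r_star_le by auto
  note coeff = odd_univalent_coeff_bounds[OF f_holo f_univ f_odd f0 f'0]
  have odd_le: "(\<Sum>n<2*N+1. norm (taylor_coeff g n) * r ^ n) \<le> 1" for N
    by (rule majorant_partial_sum_le[where a = "\<lambda>n. norm (taylor_coeff f n)"])
       (use rogosinski_subordination[OF f_holo g_holo sub] coeff g0 r in
         \<open>auto simp: power_le_one\<close>)
  \<comment> \<open>The terms are nonnegative and \<open>N\<close> is at most \<open>2*N+1\<close>,
    so the odd lengths bound every partial sum.\<close>
  have le: "(\<Sum>n<N. norm (taylor_coeff g n) * r ^ n) \<le> 1" for N
    using sum_mono2[of "{..<2*N+1}" "{..<N}" "\<lambda>n. norm (taylor_coeff g n) * r ^ n"] odd_le[of N] r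
    by auto
  have summ: "summable (\<lambda>n. norm (taylor_coeff g n) * r ^ n)"
    by (rule summableI_nonneg_bounded[OF _ le]) (use r in auto)
  moreover have "majorant g r \<le> 1"
    unfolding majorant_def by (rule suminf_le_const[OF summ le])
  ultimately show "summable (\<lambda>n. norm (taylor_coeff g n) * r ^ n) \<and> majorant g r \<le> 1" ..
qed

end
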